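(* For all $m,n\in\mathbb{N}$, the elliptic analog of the Fibonomial number can be computed as $$\genfrac{[}{]}{0pt}{0}{m+n}{n}_{\mathcal F_{a,b;q,p}}=\sum_{T\in\mathcal{T}_{m,n}}\widetilde\omega(T),\qquad\text{where}\quad \genfrac{[}{]}{0pt}{0}{m+n}{n}_{\mathcal F_{a,b;q,p}}:=\frac{[F_{m+n}]_{a,b;q,p}^!}{[F_m]_{a,b;q,p}^!\,[F_n]_{a,b;q,p}^!},$$ $\mathcal{T}_{m,n}$ is the set of path-domino tilings of an $m\times n$ rectangle and $\widetilde\omega(T)$ is the elliptic weight of $T$.
   Context: $\mathbb{N}=\{1,2,3,\dots\}$. The Fibonacci numbers are $F_0=0$, $F_1=1$, $F_n=F_{n-1}+F_{n-2}$. Theta functions: for $|p|<1$ and nonzero $x,x_1,\dots,x_\ell$, $\theta(x;p)=\prod_{j\ge0}\left((1-p^jx)\left(1-\frac{p^{j+1}}{x}\right)\right)$ and $\theta(x_1,\dots,x_\ell;p)=\prod_{k=1}^\ell\theta(x_k;p)$. Elliptic numbers: $[n]_{a,b;q,p}=\dfrac{\theta(q^n,aq^n,bq,\frac ab q;p)}{\theta(q,aq,bq^n,\frac ab q^n;p)}$. Elliptic Fibonacci factorial: $[F_n]_{a,b;q,p}^!=\prod_{k=1}^n[F_k]_{a,b;q,p}$. Here $a,b,q$ are nonzero complex parameters and $|p|<1$; identities are understood as identities of meromorphic functions of the parameters (equivalently, for generic parameters such that no denominator vanishes). The $m\times n$ rectangle has $m$ columns and $n$ rows of unit cells, with lower-left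 corner $(0,0)$ and upper-right corner $(m,n)$. A monomino is a single unit cell; a domino consists of two adjacent unit cells, horizontal ($2$ wide, $1$ high) or vertical ($1$ wide, $2$ high). A path-domino tiling of the $m\times n$ rectangle consists of a lattice path from $(0,0)$ to $(m,n)$ with unit north steps $(0,1)$ and unit east steps $(1,0)$, together with a tiling of the rectangle by monominos and dominos (each tile lying entirely above or entirely below the path) such that: (1) all tiles above the path are monominos or horizontal dominos; (2) all tiles below the path are monominos or vertical dominos; (3) every tile that touches the path from below (that is, whose top side is an east step of the path) is a vertical domino. The tiles in (3) are called special vertical dominos. (An east step at height $0$ has no tile below it and gives no condition.) $\mathcal{T}_{m,n}$ denotes the set of all path-domino tilings of the $m\times n$ rectangle. Elliptic weights: put $$v_{a,b;q,p}(m,n)=\frac{\theta(aq^{2m+n},b,bq^n,\frac ab q^n,\frac ab;p)}{\theta(aq^n,bq^m,bq^{m+n},\frac ab q^m,\frac ab q^{m+n};p)}\,q^m,$$ $$\omega_1(i,j)=v_{a,b;q^{F_j},p}(F_i,F_{i-1}),\qquad \omega_2(i,j)=v_{a,b;q,p}(F_{i+1}F_j,\,F_iF_{j-1}).$$ Let $(i,j)$ be the coordinates of the top-right corner of a tile. A monomino has weight $1$; a horizontal domino has weight $\omega_1(i,j)$; a non-special vertical domino has weight $\omega_1(j,i)$ (note the transposition); a special vertical domino has weight $\omega_2(i,j)$. The elliptic weight $\widetilde\omega(T)$ is the product of the weights of all tiles of $T$. *)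

theory Defs
  imports "HOL-Analysis.Analysis" "HOL-Number_Theory.Fib"
begin

definition theta :: "complex \<Rightarrow> complex \<Rightarrow> complex" where
  "theta x p = prodinf (\<lambda>j. (1 - p ^ j * x) * (1 - p ^ (j + 1) / x))"

definition thetas :: "complex list \<Rightarrow> complex \<Rightarrow> complex" where
  "thetas xs p = (\<Prod>x\<leftarrow>xs. theta x p)"

text \<open>
  Denominators are named separately, since identities between these expressions are asserted
  only for parameters at which no denominator vanishes.
\<close>

definition ell_num_den :: "complex \<Rightarrow> complex \<Rightarrow> complex \<Rightarrow> complex \<Rightarrow> nat \<Rightarrow> complex" where
  "ell_num_den a b q p n = thetas [q, a * q, b * q ^ n, a / b * q ^ n] p"

definition ell_num :: "complex \<Rightarrow> complex \<Rightarrow> complex \<Rightarrow> complex \<Rightarrow> nat \<Rightarrow> complex" where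
  "ell_num a b q p n = thetas [q ^ n, a * q ^ n, b * q, a * q / b] p / ell_num_den a b q p n"

definition ell_fib_fact :: "complex \<Rightarrow> complex \<Rightarrow> complex \<Rightarrow> complex \<Rightarrow> nat \<Rightarrow> complex" where
  "ell_fib_fact a b q p n = (\<Prod>k=1..n. ell_num a b q p (fib k))"

definition ell_fibonomial :: "complex \<Rightarrow> complex \<Rightarrow> complex \<Rightarrow> complex \<Rightarrow> nat \<Rightarrow> nat \<Rightarrow> complex" where
  "ell_fibonomial a b q p N k =
     ell_fib_fact a b q p N / (ell_fib_fact a b q p (N - k) * ell_fib_fact a b q p k)"

definition v_den :: "complex \<Rightarrow> complex \<Rightarrow> complex \<Rightarrow> complex \<Rightarrow> nat \<Rightarrow> nat \<Rightarrow> complex" where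
  "v_den a b q p m n =
     thetas [a * q ^ n, b * q ^ m, b * q ^ (m + n), a / b * q ^ m, a / b * q ^ (m + n)] p"

definition v_weight :: "complex \<Rightarrow> complex \<Rightarrow> complex \<Rightarrow> complex \<Rightarrow> nat \<Rightarrow> nat \<Rightarrow> complex" where
  "v_weight a b q p m n =
     thetas [a * q ^ (2 * m + n), b, b * q ^ n, a / b * q ^ n, a / b] p / v_den a b q p m n * q ^ m"

definition omega1 :: "complex \<Rightarrow> complex \<Rightarrow> complex \<Rightarrow> complex \<Rightarrow> nat \<Rightarrow> nat \<Rightarrow> complex" where
  "omega1 a b q p i j = v_weight a b (q ^ fib j) p (fib i) (fib (i - 1))"

definition omega2 :: "complex \<Rightarrow> complex \<Rightarrow> complex \<Rightarrow> complex \<Rightarrow> nat \<Rightarrow> nat \<Rightarrow> complex" where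
  "omega2 a b q p i j = v_weight a b q p (fib (i + 1) * fib j) (fib i * fib (j - 1))"

definition omega1_den :: "complex \<Rightarrow> complex \<Rightarrow> complex \<Rightarrow> complex \<Rightarrow> nat \<Rightarrow> nat \<Rightarrow> complex" where
  "omega1_den a b q p i j = v_den a b (q ^ fib j) p (fib i) (fib (i - 1))"

definition omega2_den :: "complex \<Rightarrow> complex \<Rightarrow> complex \<Rightarrow> complex \<Rightarrow> nat \<Rightarrow> nat \<Rightarrow> complex" where
  "omega2_den a b q p i j = v_den a b q p (fib (i + 1) * fib j) (fib i * fib (j - 1))"

datatype step = North | East

definition lattice_paths :: "nat \<Rightarrow> nat \<Rightarrow> step list set" where
  "lattice_paths m n = {w. count_list w East = m \<and> count_list w North = n}"

definition path_pos :: "step list \<Rightarrow> nat \<Rightarrow> nat \<times> nat" where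
  "path_pos w k = (count_list (take k w) East, count_list (take k w) North)"

text \<open>East steps are represented by their right endpoints.\<close>

definition east_steps :: "step list \<Rightarrow> (nat \<times> nat) set" where
  "east_steps w = {path_pos w (Suc k) |k. k < length w \<and> w ! k = East}"

text \<open>
  A unit cell is represented by the coordinates of its top-right corner, so the cell \<open>(i, j)\<close> is
  the square \<open>[i - 1, i] \<times> [j - 1, j]\<close>, and the cells of the \<open>m \<times> n\<close> rectangle are
  \<open>{1..m} \<times> {1..n}\<close>. A cell lies below (above) the path if it lies below (above) the east step
  in its column.
\<close>

definition cell_below :: "step list \<Rightarrow> nat \<times> nat \<Rightarrow> bool" where
  "cell_below w c \<longleftrightarrow> (\<exists>h. (fst c, h) \<in> east_steps w \<and> snd c \<le> h)"

definition cell_above :: "step list \<Rightarrow> nat \<times> nat \<Rightarrow> bool" where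
  "cell_above w c \<longleftrightarrow> (\<exists>h. (fst c, h) \<in> east_steps w \<and> h < snd c)"

text \<open>
  Every tile carries the coordinates of its top-right corner. Truncated subtraction in
  \<open>tile_cells\<close> is harmless: a tile of a tiling lies in the rectangle, and a truncated
  coordinate gives a cell with a zero coordinate, which does not.
\<close>

datatype tile = Mono nat nat | HDom nat nat | VDom nat nat

fun tile_cells :: "tile \<Rightarrow> (nat \<times> nat) set" where
  "tile_cells (Mono i j) = {(i, j)}"
| "tile_cells (HDom i j) = {(i - 1, j), (i, j)}"
| "tile_cells (VDom i j) = {(i, j - 1), (i, j)}"

fun top_right :: "tile \<Rightarrow> nat \<times> nat" where
  "top_right (Mono i j) = (i, j)"
| "top_right (HDom i j) = (i, j)"
| "top_right (VDom i j) = (i, j)"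

definition is_tiling :: "nat \<Rightarrow> nat \<Rightarrow> tile set \<Rightarrow> bool" where
  "is_tiling m n S \<longleftrightarrow>
     disjoint_family_on tile_cells S \<and> (\<Union>t\<in>S. tile_cells t) = {1..m} \<times> {1..n}"

definition tile_below :: "step list \<Rightarrow> tile \<Rightarrow> bool" where
  "tile_below w t \<longleftrightarrow> (\<forall>c\<in>tile_cells t. cell_below w c)"

definition tile_above :: "step list \<Rightarrow> tile \<Rightarrow> bool" where
  "tile_above w t \<longleftrightarrow> (\<forall>c\<in>tile_cells t. cell_above w c)"

text \<open>
  A tile below the path has width 1, so its top side is the unit segment whose right endpoint is
  the top-right corner of the tile.
\<close>

definition touches_from_below :: "step list \<Rightarrow> tile \<Rightarrow> bool" where
  "touches_from_below w t \<longleftrightarrow> tile_below w t \<and> top_right t \<in> east_steps w"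

definition path_domino_tilings :: "nat \<Rightarrow> nat \<Rightarrow> (step list \<times> tile set) set" where
  "path_domino_tilings m n =
     {(w, S). w \<in> lattice_paths m n \<and> is_tiling m n S \<and>
        (\<forall>t\<in>S. tile_above w t \<or> tile_below w t) \<and>
        (\<forall>t\<in>S. tile_above w t \<longrightarrow> (\<exists>i j. t = Mono i j \<or> t = HDom i j)) \<and>
        (\<forall>t\<in>S. tile_below w t \<longrightarrow> (\<exists>i j. t = Mono i j \<or> t = VDom i j)) \<and>
        (\<forall>t\<in>S. touches_from_below w t \<longrightarrow> (\<exists>i j. t = VDom i j))}"

fun tile_weight ::
  "complex \<Rightarrow> complex \<Rightarrow> complex \<Rightarrow> complex \<Rightarrow> step list \<Rightarrow> tile \<Rightarrow> complex" where
  "tile_weight a b q p w (Mono i j) = 1"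
| "tile_weight a b q p w (HDom i j) = omega1 a b q p i j"
| "tile_weight a b q p w (VDom i j) =
     (if touches_from_below w (VDom i j) then omega2 a b q p i j else omega1 a b q p j i)"

fun tile_weight_den ::
  "complex \<Rightarrow> complex \<Rightarrow> complex \<Rightarrow> complex \<Rightarrow> step list \<Rightarrow> tile \<Rightarrow> complex" where
  "tile_weight_den a b q p w (Mono i j) = 1"
| "tile_weight_den a b q p w (HDom i j) = omega1_den a b q p i j"
| "tile_weight_den a b q p w (VDom i j) =
     (if touches_from_below w (VDom i j) then omega2_den a b q p i j else omega1_den a b q p j i)"

definition elliptic_weight ::
  "complex \<Rightarrow> complex \<Rightarrow> complex \<Rightarrow> complex \<Rightarrow> step list \<times> tile set \<Rightarrow> complex" where
  "elliptic_weight a b q p T = (\<Prod>t\<in>snd T. tile_weight a b q p (fst T) t)"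

lemma tiling_subset_tiles:
  assumes "is_tiling m n S"
  shows "S \<subseteq> (\<lambda>(f, i, j). f i j) ` ({Mono, HDom, VDom} \<times> {1..m} \<times> {1..n})"
proof
  fix t assume "t \<in> S"
  then have "tile_cells t \<subseteq> {1..m} \<times> {1..n}"
    using assms unfolding is_tiling_def by blast
  then show "t \<in> (\<lambda>(f, i, j). f i j) ` ({Mono, HDom, VDom} \<times> {1..m} \<times> {1..n})"
    by (cases t) (auto simp: image_iff)
qed

lemma finite_path_domino_tilings: "finite (path_domino_tilings m n)"
proof -
  have len: "length w = count_list w East + count_list w North" for w :: "step list"
  proof (induction w)
    case (Cons s w)
    then show ?case by (cases s) auto
  qed simp
  have univ: "(UNIV :: step set) = {North, East}"
    using step.exhaust by blast
  let ?P = "{w :: step list. set w \<subseteq> UNIV \<and> length w = m + n}"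
  let ?S = "Pow ((\<lambda>(f, i, j). f i j) ` ({Mono, HDom, VDom} \<times> {1..m} \<times> {1..n}))"
  have "finite ?P"
    by (rule finite_lists_length_eq) (simp add: univ)
  then have "finite (?P \<times> ?S)"
    by simp
  moreover have "path_domino_tilings m n \<subseteq> ?P \<times> ?S"
    using tiling_subset_tiles len unfolding path_domino_tilings_def lattice_paths_def by fastforce
  ultimately show ?thesis
    by (rule rev_finite_subset)
qed

end

theory Submission
  imports Defs
begin

text \<open>
  Write \<open>N(X) = \<theta>(X) \<theta>(aX) / (\<theta>(bX) \<theta>(aX/b))\<close>, so that \<open>[n] = N(q^n) / N(q)\<close>. The Weierstrass addition
  formula for \<open>\<theta>\<close> gives \<open>N(XY) = N(X) + v N(Y)\<close> with \<open>v\<close> the elliptic weight. Reading off the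
  Fibonacci recurrence, the tilings of a strip of length \<open>k\<close> in row or column \<open>j\<close> have total weight
  \<open>N(q^(F_j F_(k+1))) / N(q^(F_j))\<close>, and reading off
  \<open>F_(i+j) = F_(i+1) F_j + F_i F_(j-1)\<close> one obtains a two-term recurrence for the Fibonomials. Removing
  the last step of the path together with the row above it or the column below it gives the
  same recurrence for the tilings.

  The addition formula follows from the Laurent series of \<open>\<theta>\<close>: splitting the double series of
  \<open>\<theta>(xy) \<theta>(x/y)\<close> by the parity of the summation indices shows that it is a sum of two products of a
  function of \<open>x\<close> and a function of \<open>y\<close>. Being antisymmetric after division by \<open>x\<close>, it satisfies the
  Pluecker relation, which is the addition formula.
\<close>

section \<open>The addition formula for theta functions\<close>

text \<open>Closed form \<open>(-1)^k p^(k(k-1)/2) / ((1-p) ... (1-p^k))\<close>: the coefficients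
  in Euler's expansion of the infinite product of the factors \<open>1 - p^j x\<close>.\<close>

primrec euler_coeff :: "complex \<Rightarrow> nat \<Rightarrow> complex" where
  "euler_coeff p 0 = 1"
| "euler_coeff p (Suc k) = - (p ^ k / (1 - p ^ Suc k)) * euler_coeff p k"

definition euler_series :: "complex \<Rightarrow> complex \<Rightarrow> complex" where
  "euler_series p x = (\<Sum>k. euler_coeff p k * x ^ k)"

text \<open>Extension by zero to negative indices, so that double series can be reindexed over all
  pairs of integers.\<close>

definition euler_coeff_int :: "complex \<Rightarrow> int \<Rightarrow> complex" where
  "euler_coeff_int p k = (if k < 0 then 0 else euler_coeff p (nat k))"

text \<open>The coefficient of \<open>x^n\<close> in
  \<open>euler_series p x * euler_series p (p / x)\<close>, collected over index pairs
  \<open>(n + l, l)\<close>.\<close>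

definition theta_coeff :: "complex \<Rightarrow> int \<Rightarrow> complex" where
  "theta_coeff p n = (\<Sum>\<^sub>\<infinity>l. euler_coeff_int p (n + l) * euler_coeff_int p l * p powi l)"

lemma summable_on_Times_mult:
  fixes f :: "'a \<Rightarrow> complex" and g :: "'b \<Rightarrow> complex"
  assumes "f summable_on A" and "g summable_on B"
  shows "(\<lambda>(x, y). f x * g y) summable_on A \<times> B"
proof -
  have "(\<lambda>x. norm (f x)) summable_on A" "(\<lambda>x. norm (g x)) summable_on B"
    using assms by (simp_all add: summable_on_iff_abs_summable_on_complex)
  then have "(\<lambda>z. norm (case z of (x, y) \<Rightarrow> f x * g y)) summable_on A \<times> B"
    unfolding Infinite_Sum.abs_summable_on_Sigma_iff
    by (auto simp: norm_mult infsum_cmult_right' summable_on_cmult_left summable_on_cmult_right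
        abs_mult abs_of_nonneg infsum_nonneg)
  then show ?thesis
    by (simp add: summable_on_iff_abs_summable_on_complex)
qed

lemma theta_LIMSEQ:
  assumes "norm p < 1"
  shows "(\<lambda>n. \<Prod>j\<le>n. (1 - p ^ j * x) * (1 - p ^ (j + 1) / x)) \<longlonglongrightarrow> theta x p"
proof -
  have "convergent_prod (\<lambda>j. 1 - p ^ j * c)" for c
  proof (rule abs_convergent_prod_imp_convergent_prod, unfold abs_convergent_prod_conv_summable)
    have "summable (\<lambda>j. norm c * norm p ^ j)"
      using assms by (intro summable_mult summable_geometric) simp
    then show "summable (\<lambda>j. norm (1 - p ^ j * c - 1))"
      by (simp add: norm_mult norm_power mult.commute)
  qed
  from this[of x] this[of "p / x"]
  have "convergent_prod (\<lambda>j. (1 - p ^ j * x) * (1 - p ^ (j + 1) / x))"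
    by (intro convergent_prod_mult) (simp_all add: mult.commute)
  then show ?thesis
    unfolding theta_def by (rule convergent_prod_LIMSEQ)
qed

text \<open>Since \<open>0 ^ 0 = 1\<close>, only the factor \<open>1 - x\<close> at
  \<open>j = 0\<close> survives. The context below assumes \<open>p \<noteq> 0\<close>, so nome 0 is
  settled by this formula.\<close>

lemma theta_nome_zero: "theta x 0 = 1 - x"
proof -
  have "(\<Prod>j\<le>n. (1 - 0 ^ j * x) * (1 - 0 ^ (j + 1) / x)) = 1 - x" for n
    by (induction n) auto
  then show ?thesis
    using theta_LIMSEQ[of 0 x] by (simp only: LIMSEQ_const_iff norm_zero zero_less_one)
qed

section \<open>Euler's series for the infinite product\<close>

context
  fixes p :: complex
  assumes p_less: "norm p < 1" and p_nz: "p \<noteq> 0"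
begin

lemma one_minus_power_nz: "1 - p ^ Suc k \<noteq> 0"
proof
  assume "1 - p ^ Suc k = 0"
  then have "norm p ^ Suc k = 1"
    by (metis eq_iff_diff_eq_0 norm_one norm_power)
  then show False
    using p_less power_Suc_less_one[of "norm p" k] p_nz by auto
qed

lemma euler_coeff_Suc_mult: "(1 - p ^ Suc k) * euler_coeff p (Suc k) = - (p ^ k * euler_coeff p k)"
  using one_minus_power_nz[of k] by simp

text \<open>The ratio of consecutive terms tends to 0, so the series converges absolutely for every
  \<open>x\<close>.\<close>

lemma summable_euler: "summable (\<lambda>k. norm (euler_coeff p k * x ^ k))"
proof -
  have "(\<lambda>k. - (p ^ k / (1 - p ^ Suc k)) * x) \<longlonglongrightarrow> - (0 / (1 - 0)) * x"
    by (intro tendsto_intros LIMSEQ_power_zero filterlim_compose[OF LIMSEQ_power_zero] p_less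
        filterlim_Suc) simp
  then have "(\<lambda>k. norm (- (p ^ k / (1 - p ^ Suc k)) * x)) \<longlonglongrightarrow> 0"
    by (intro tendsto_norm_zero) simp
  then have "eventually (\<lambda>k. norm (- (p ^ k / (1 - p ^ Suc k)) * x) < 1/2) sequentially"
    by (rule order_tendstoD) simp
  then obtain N where N: "\<And>k. k \<ge> N \<Longrightarrow> norm (- (p ^ k / (1 - p ^ Suc k)) * x) < 1/2"
    unfolding eventually_sequentially by blast
  show ?thesis
  proof (rule summable_ratio_test[of "1/2" N])
    fix k assume "N \<le> k"
    have "norm (euler_coeff p (Suc k) * x ^ Suc k)
        = norm (- (p ^ k / (1 - p ^ Suc k)) * x) * norm (euler_coeff p k * x ^ k)"
      by (simp add: norm_mult norm_divide norm_power field_simps)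
    also have "\<dots> \<le> 1/2 * norm (euler_coeff p k * x ^ k)"
      by (intro mult_right_mono less_imp_le[OF N] \<open>N \<le> k\<close>) simp
    finally show "norm (norm (euler_coeff p (Suc k) * x ^ Suc k)) \<le> 1/2 * norm (norm (euler_coeff p k * x ^ k))"
      by simp
  qed simp
qed

text \<open>By \<open>euler_coeff_Suc_mult\<close> the series satisfies, coefficient by coefficient,
  the functional equation of the infinite product.\<close>

lemma euler_series_step: "euler_series p x = (1 - x) * euler_series p (p * x)"
proof -
  have s: "summable (\<lambda>k. euler_coeff p k * y ^ k)" for y
    by (rule summable_norm_cancel[OF summable_euler])
  have c: "euler_coeff p (Suc k) * x ^ Suc k - euler_coeff p (Suc k) * (p * x) ^ Suc k
      = - x * (euler_coeff p k * (p * x) ^ k)" for k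
  proof -
    have "euler_coeff p (Suc k) * x ^ Suc k - euler_coeff p (Suc k) * (p * x) ^ Suc k
        = (1 - p ^ Suc k) * euler_coeff p (Suc k) * x ^ Suc k"
      by (simp del: euler_coeff.simps power_Suc add: power_mult_distrib algebra_simps)
    also have "\<dots> = - x * (euler_coeff p k * (p * x) ^ k)"
      unfolding euler_coeff_Suc_mult by (simp add: power_mult_distrib)
    finally show ?thesis .
  qed
  have "euler_series p x - euler_series p (p * x)
      = (\<Sum>k. euler_coeff p k * x ^ k - euler_coeff p k * (p * x) ^ k)"
    unfolding euler_series_def by (rule suminf_diff[OF s s])
  also have "\<dots> = (\<Sum>k. euler_coeff p (Suc k) * x ^ Suc k - euler_coeff p (Suc k) * (p * x) ^ Suc k)"
    using suminf_split_head[OF summable_diff[OF s[of x] s[of "p * x"]]] by simp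
  also have "\<dots> = - x * euler_series p (p * x)"
    unfolding c euler_series_def by (rule suminf_mult[OF s])
  finally show ?thesis
    by (simp add: algebra_simps)
qed

text \<open>Iterating the functional equation leaves the remainder
  \<open>euler_series p (p ^ n * x)\<close>, which tends to \<open>euler_series p 0 = 1\<close> by
  continuity. It is therefore eventually nonzero and can be divided out.\<close>

lemma euler_series_product: "(\<lambda>n. \<Prod>j\<le>n. 1 - p ^ j * x) \<longlonglongrightarrow> euler_series p x"
proof -
  have eq: "euler_series p x = (\<Prod>j<n. 1 - p ^ j * x) * euler_series p (p ^ n * x)" for n
  proof (induction n)
    case (Suc n)
    then show ?case
      using euler_series_step[of "p ^ n * x"] by (simp add: mult.assoc)
  qed simp
  have cont: "isCont (euler_series p) 0"
    unfolding euler_series_def[abs_def]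
    by (rule isCont_powser'[of _ _ _ 1])
       (use summable_norm_cancel[OF summable_euler[of 1]] in auto)
  have "(\<lambda>n. p ^ Suc n * x) \<longlonglongrightarrow> 0 * x"
    by (intro tendsto_intros filterlim_compose[OF LIMSEQ_power_zero] p_less filterlim_Suc)
  then have "(\<lambda>n. euler_series p (p ^ Suc n * x)) \<longlonglongrightarrow> euler_series p 0"
    using isCont_tendsto_compose[OF cont] by simp
  moreover have S0: "euler_series p 0 = 1"
    unfolding euler_series_def by (subst powser_zero) simp
  ultimately have lim: "(\<lambda>n. euler_series p (p ^ Suc n * x)) \<longlonglongrightarrow> 1"
    by simp
  have "(\<lambda>n. euler_series p x / euler_series p (p ^ Suc n * x)) \<longlonglongrightarrow> euler_series p x / 1"
    by (intro tendsto_divide tendsto_const lim) simp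
  moreover have "eventually (\<lambda>n. euler_series p (p ^ Suc n * x) \<noteq> 0) sequentially"
    using lim tendsto_imp_eventually_ne by fastforce
  then have "eventually (\<lambda>n. euler_series p x / euler_series p (p ^ Suc n * x)
      = (\<Prod>j\<le>n. 1 - p ^ j * x)) sequentially"
  proof eventually_elim
    case (elim n)
    then show ?case
      using eq[of "Suc n"] by (simp add: lessThan_Suc_atMost field_simps)
  qed
  ultimately show ?thesis
    by (simp add: tendsto_cong)
qed

section \<open>Laurent coefficients of theta\<close>

lemma theta_euler_series: "theta x p = euler_series p x * euler_series p (p / x)"
proof (rule LIMSEQ_unique[OF theta_LIMSEQ[OF p_less]])
  show "(\<lambda>n. \<Prod>j\<le>n. (1 - p ^ j * x) * (1 - p ^ (j + 1) / x))
      \<longlonglongrightarrow> euler_series p x * euler_series p (p / x)"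
    using tendsto_mult[OF euler_series_product[of x]
        euler_series_product[of "p / x"]]
    by (simp add: prod.distrib mult.commute)
qed

text \<open>The recurrence survives the extension by zero: at \<open>k = -1\<close> the factor
  \<open>1 - p powi 0\<close> vanishes.\<close>

lemma euler_coeff_int_rec:
  "(1 - p powi (k + 1)) * euler_coeff_int p (k + 1) = - (p powi k * euler_coeff_int p k)"
proof -
  consider "k < -1" | "k = -1" | "k \<ge> 0"
    by linarith
  then show ?thesis
  proof cases
    case 3
    then obtain j where "k = int j"
      using nonneg_int_cases by blast
    then show ?thesis
      using euler_coeff_Suc_mult[of j]
      by (simp add: euler_coeff_int_def nat_add_distrib power_int_add p_nz algebra_simps)
  qed (auto simp: euler_coeff_int_def)
qed

lemma euler_series_has_sum:
  assumes "x \<noteq> 0"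
  shows "((\<lambda>k. euler_coeff_int p k * x powi k) has_sum euler_series p x) UNIV"
proof -
  have "((\<lambda>k. euler_coeff p k * x ^ k) has_sum euler_series p x) UNIV"
    unfolding euler_series_def
    by (intro norm_summable_imp_has_sum summable_euler summable_sums
        summable_norm_cancel[OF summable_euler])
  also have "?this \<longleftrightarrow> ((\<lambda>k. euler_coeff_int p k * x powi k) has_sum euler_series p x) {0..}"
    by (rule has_sum_reindex_bij_witness[of _ nat int]) (auto simp: euler_coeff_int_def)
  also have "\<dots> \<longleftrightarrow> ((\<lambda>k. euler_coeff_int p k * x powi k) has_sum euler_series p x) UNIV"
    by (rule has_sum_cong_neutral) (auto simp: euler_coeff_int_def)
  finally show ?thesis .
qed

text \<open>The two Euler series converge absolutely; their product is rearranged by the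
  substitution \<open>k = n + l\<close>.\<close>

lemma theta_double_series:
  assumes "x \<noteq> 0"
  shows "(\<lambda>(n, l). euler_coeff_int p (n + l) * euler_coeff_int p l * p powi l * x powi n) summable_on UNIV"
    and "theta x p = (\<Sum>\<^sub>\<infinity>(n, l). euler_coeff_int p (n + l) * euler_coeff_int p l * p powi l * x powi n)"
proof -
  let ?e = "euler_coeff_int p"
  let ?g = "\<lambda>(k, l). (?e k * x powi k) * (?e l * (p / x) powi l)"
  let ?f = "\<lambda>(n, l). ?e (n + l) * ?e l * p powi l * x powi n"
  have px: "p / x \<noteq> 0"
    using assms p_nz by simp
  have hx: "((\<lambda>k. ?e k * x powi k) has_sum euler_series p x) UNIV"
   and hpx: "((\<lambda>l. ?e l * (p / x) powi l) has_sum euler_series p (p / x)) UNIV"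
    using euler_series_has_sum assms px by auto
  have gs: "?g summable_on UNIV \<times> UNIV"
    by (rule summable_on_Times_mult) (use hx hpx in \<open>auto simp: has_sum_imp_summable\<close>)
  have gi: "infsum ?g (UNIV \<times> UNIV) = theta x p"
  proof -
    have "infsum ?g (UNIV \<times> UNIV)
        = (\<Sum>\<^sub>\<infinity>k. \<Sum>\<^sub>\<infinity>l. (?e k * x powi k) * (?e l * (p / x) powi l))"
      using infsum_Sigma'_banach[OF gs] by simp
    also have "\<dots> = euler_series p x * euler_series p (p / x)"
      using infsumI[OF hx] infsumI[OF hpx] by (simp add: infsum_cmult_right' infsum_cmult_left')
    finally show ?thesis
      by (simp add: theta_euler_series)
  qed
  have bij: "bij_betw (\<lambda>(n, l). (n + l, l)) (UNIV \<times> UNIV) (UNIV \<times> (UNIV :: int set))"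
    by (rule bij_betwI[of _ _ _ "\<lambda>(k, l). (k - l, l)"]) auto
  have fg: "?g (case z of (n, l) \<Rightarrow> (n + l, l)) = ?f z" for z
    using assms p_nz by (cases z) (simp add: power_int_add power_int_divide_distrib)
  show "?f summable_on UNIV"
    using summable_on_reindex_bij_betw[OF bij, of ?g] gs by (simp only: fg UNIV_Times_UNIV)
  show "theta x p = infsum ?f UNIV"
    using infsum_reindex_bij_betw[OF bij, of ?g] gi by (simp only: fg UNIV_Times_UNIV)
qed

text \<open>Summing the double series over \<open>l\<close> first collects the coefficient of each
  power of \<open>x\<close>.\<close>

lemma theta_laurent:
  assumes "x \<noteq> 0"
  shows "((\<lambda>n. theta_coeff p n * x powi n) has_sum theta x p) UNIV"
proof -
  let ?e = "euler_coeff_int p"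
  note s = theta_double_series[OF assms]
  have "((\<lambda>(n, l). ?e (n + l) * ?e l * p powi l * x powi n) has_sum theta x p) (UNIV \<times> UNIV)"
    using has_sum_infsum[OF s(1)] s(2) by simp
  then have "((\<lambda>n. \<Sum>\<^sub>\<infinity>l. ?e (n + l) * ?e l * p powi l * x powi n) has_sum theta x p) UNIV"
    by (rule has_sum_Sigma') (use summable_on_SigmaD1[of "\<lambda>n l. ?e (n + l) * ?e l * p powi l * x powi n"
        UNIV "\<lambda>_. UNIV"] s(1) in \<open>auto simp: has_sum_infsum\<close>)
  then show ?thesis
    by (simp add: theta_coeff_def infsum_cmult_left')
qed

lemma theta_coeff_summable:
  "(\<lambda>l. euler_coeff_int p (n + l) * euler_coeff_int p l * p powi l) summable_on UNIV"
proof -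
  have "(\<lambda>(n, l). euler_coeff_int p (n + l) * euler_coeff_int p l * p powi l) summable_on UNIV \<times> UNIV"
    using theta_double_series(1)[of 1] by simp
  then show ?thesis
    by (rule summable_on_SigmaD1) simp
qed

text \<open>The Laurent series converges at \<open>x = 1\<close>, so its terms there, the
  coefficients themselves, tend to 0.\<close>

lemma theta_coeff_tendsto_0: "(\<lambda>n. theta_coeff p (int n)) \<longlonglongrightarrow> 0"
proof -
  have "theta_coeff p summable_on UNIV"
    using has_sum_imp_summable[OF theta_laurent[of 1]] by simp
  then have "theta_coeff p summable_on range int"
    by (rule summable_on_subset_banach) simp
  then have "(\<lambda>n. theta_coeff p (int n)) summable_on UNIV"
    by (simp add: summable_on_reindex o_def)
  then show ?thesis
    by (intro summable_LIMSEQ_zero summable_on_imp_summable)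
qed

text \<open>This is the quasi-periodicity \<open>theta(px) = - theta(x) / x\<close> in terms of
  coefficients. The recurrence for the Euler coefficients gives only that the defect is the same for
  all \<open>n\<close>; decay of the coefficients forces it to be 0.\<close>

lemma theta_coeff_rec: "theta_coeff p (n + 1) = - (p powi n * theta_coeff p n)"
proof -
  let ?e = "euler_coeff_int p"
  let ?d = "theta_coeff p"
  have step: "?d (n + 1) + p powi n * ?d n = ?d (n + 2) + p powi (n + 1) * ?d (n + 1)" for n
  proof -
    let ?t = "\<lambda>n l. ?e (n + l) * ?e l * p powi l"
    \<comment> \<open>The Euler recurrence is used at \<open>n + l\<close> and at
      \<open>l - 1\<close>. The shift in \<open>l\<close> on the right disappears after summation
      over all integers.\<close>
    have *: "?t (n + 1) l + p powi n * ?t n l - p powi (n + 1) * ?t (n + 1) l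
        = ?t (n + 2) (l - 1)" for l
    proof -
      define A B C D where "A = ?e (n + l)" "B = ?e (n + l + 1)" "C = ?e l" "D = ?e (l - 1)"
      have 1: "p powi (n + l) * A = - ((1 - p powi (n + l + 1)) * B)"
        using euler_coeff_int_rec[of "n + l"] by (simp add: A_B_C_D_def)
      have 2: "p powi (l - 1) * D = - ((1 - p powi l) * C)"
        using euler_coeff_int_rec[of "l - 1"] by (simp add: A_B_C_D_def)
      have "?t (n + 1) l + p powi n * ?t n l - p powi (n + 1) * ?t (n + 1) l
          = C * (B * p powi l + p powi (n + l) * A - p powi (n + l + 1) * B)"
        by (simp add: A_B_C_D_def power_int_add p_nz algebra_simps)
      also have "\<dots> = B * (p powi (l - 1) * D)"
        unfolding 1 2 by (simp add: algebra_simps)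
      also have "\<dots> = ?t (n + 2) (l - 1)"
        by (simp add: A_B_C_D_def algebra_simps)
      finally show ?thesis .
    qed
    have h: "(?t n has_sum ?d n) UNIV" for n
      unfolding theta_coeff_def by (rule has_sum_infsum[OF theta_coeff_summable])
    have "((\<lambda>l. ?t (n + 1) l + p powi n * ?t n l + (- (p powi (n + 1))) * ?t (n + 1) l)
        has_sum (?d (n + 1) + p powi n * ?d n + (- (p powi (n + 1))) * ?d (n + 1))) UNIV"
      by (intro has_sum_add has_sum_cmult_right h)
    then have "((\<lambda>l. ?t (n + 1) l + p powi n * ?t n l - p powi (n + 1) * ?t (n + 1) l)
        has_sum (?d (n + 1) + p powi n * ?d n - p powi (n + 1) * ?d (n + 1))) UNIV"
      by simp
    then have "((\<lambda>l. ?t (n + 2) (l - 1))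
        has_sum (?d (n + 1) + p powi n * ?d n - p powi (n + 1) * ?d (n + 1))) UNIV"
      by (simp only: *)
    also have "?this \<longleftrightarrow> (?t (n + 2)
        has_sum (?d (n + 1) + p powi n * ?d n - p powi (n + 1) * ?d (n + 1))) UNIV"
      by (rule has_sum_reindex_bij_witness[of _ "\<lambda>l. l + 1" "\<lambda>l. l - 1"]) auto
    finally show ?thesis
      using has_sum_unique[OF _ h[of "n + 2"]] by (metis add_diff_cancel_right' diff_add_cancel)
  qed
  \<comment> \<open>By \<open>step\<close>, \<open>K\<close> does not depend on \<open>n\<close>; as \<open>n\<close> tends to infinity it tends to 0.\<close>
  define K where "K n = ?d (n + 1) + p powi n * ?d n" for n
  have K_step: "K (n + 1) = K n" for n
    unfolding K_def using step[of n] by (simp only: add.assoc one_add_one)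
  have K_shift: "K (n + int k) = K n" for n k
  proof (induction k)
    case (Suc k)
    then show ?case
      using K_step[of "n + int k"] by (simp add: algebra_simps)
  qed simp
  have "(\<lambda>k. K (int k)) \<longlonglongrightarrow> 0 + 0 * 0"
  proof -
    have "(\<lambda>k. ?d (int (Suc k)) + p ^ k * ?d (int k)) \<longlonglongrightarrow> 0 + 0 * 0"
      by (intro tendsto_intros theta_coeff_tendsto_0 LIMSEQ_power_zero p_less
          filterlim_compose[OF theta_coeff_tendsto_0] filterlim_Suc)
    then show ?thesis
      by (simp add: K_def add.commute)
  qed
  then have "K 0 = 0"
    using K_shift[of 0] by (simp add: LIMSEQ_const_iff)
  then have "K n = 0"
    using K_shift[of 0 "nat n"] K_shift[of n "nat (- n)"] by (cases "n \<ge> 0") auto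
  then show ?thesis
    by (simp add: K_def eq_neg_iff_add_eq_0)
qed

text \<open>Jacobi's triple product up to the constant \<open>theta_coeff p 0\<close>, by induction
  from 0 in both directions.\<close>

lemma theta_coeff_closed:
  "theta_coeff p n = theta_coeff p 0 * ((- 1) powi n * p powi (n * (n - 1) div 2))"
proof -
  define s where "s n = (- 1) powi n * p powi (n * (n - 1) div 2)" for n :: int
  have s_rec: "s (n + 1) = - (p powi n * s n)" for n
  proof -
    have "(n + 1) * (n + 1 - 1) div 2 = n * (n - 1) div 2 + n"
      by (simp add: algebra_simps flip: div_mult_self3)
    then show ?thesis
      by (simp add: s_def power_int_add p_nz)
  qed
  have "theta_coeff p n = theta_coeff p 0 * s n"
  proof (induction n rule: int_induct[of _ 0])
    case base
    then show ?case
      by (simp add: s_def)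
  next
    case (step1 i)
    then show ?case
      by (simp add: theta_coeff_rec s_rec)
  next
    case (step2 i)
    then show ?case
      using theta_coeff_rec[of "i - 1"] s_rec[of "i - 1"] p_nz by simp
  qed
  then show ?thesis
    by (simp add: s_def)
qed

section \<open>Separation of variables in theta(xy) theta(x/y)\<close>

lemma theta_coeff_mult:
  "theta_coeff p m * theta_coeff p n = (theta_coeff p 0)\<^sup>2 *
     ((- 1) powi (m + n) * p powi ((m * (m - 1) + n * (n - 1)) div 2))"
proof -
  have "(m * (m - 1) + n * (n - 1)) div 2 = m * (m - 1) div 2 + n * (n - 1) div 2"
    by (rule div_plus_div_distrib_dvd_left) simp
  then show ?thesis
    by (subst theta_coeff_closed[of m], subst theta_coeff_closed[of n])
       (simp add: power_int_add p_nz power2_eq_square)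
qed

text \<open>The general term of the double series contains \<open>x^(m+n) y^(m-n)\<close>. Putting
  \<open>(m, n) = (s + d, s - d)\<close> for even \<open>m + n\<close> and
  \<open>(s + d + 1, s - d)\<close> for odd \<open>m + n\<close> makes the quadratic exponent of
  \<open>p\<close> a sum of a part in \<open>s\<close> and a part in \<open>d\<close>, so each
  parity class factors.\<close>

lemma theta_rank_two:
  "\<exists>f0 f1 g0 g1. \<forall>x y. x \<noteq> 0 \<longrightarrow> y \<noteq> 0 \<longrightarrow>
     theta (x * y) p * theta (x / y) p = f0 x * g0 y + f1 x * g1 y"
proof -
  define c where "c = (theta_coeff p 0)\<^sup>2"
  define f0 where "f0 x = (\<Sum>\<^sub>\<infinity>s::int. c * p powi (s * s - s) * x powi (2 * s))" for x
  define g0 where "g0 y = (\<Sum>\<^sub>\<infinity>d::int. p powi (d * d) * y powi (2 * d))" for y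
  \<comment> \<open>The minus sign is \<open>(-1)^(m+n)\<close> in the class of odd
    \<open>m + n\<close>.\<close>
  define f1 where "f1 x = (\<Sum>\<^sub>\<infinity>s::int. - c * p powi (s * s) * x powi (2 * s + 1))" for x
  define g1 where "g1 y = (\<Sum>\<^sub>\<infinity>d::int. p powi (d * d + d) * y powi (2 * d + 1))" for y
  have "theta (x * y) p * theta (x / y) p = f0 x * g0 y + f1 x * g1 y"
    if nz: "x \<noteq> 0" "y \<noteq> 0" for x y
  proof -
    let ?d = "theta_coeff p"
    define F where "F = (\<lambda>(m, n). (?d m * (x * y) powi m) * (?d n * (x / y) powi n))"
    define E O' :: "(int \<times> int) set" where "E = {(m, n). even (m + n)}" and "O' = {(m, n). odd (m + n)}"
    have l1: "((\<lambda>n. ?d n * (x * y) powi n) has_sum theta (x * y) p) UNIV"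
     and l2: "((\<lambda>n. ?d n * (x / y) powi n) has_sum theta (x / y) p) UNIV"
      using nz by (auto intro!: theta_laurent)
    have double: "z powi (2 * k) = z powi k * z powi k" if "z \<noteq> 0" for z :: complex and k
      using power_int_add[of z k k] that by (simp only: mult_2) simp
    have half: "(m + n) div 2 + (m - n) div 2 = m" if "odd m" "odd n" for m n :: int
      using that by (elim oddE) simp
    have odd_half: "(m + n - 1) div 2 + (m - n - 1) div 2 + 1 = m"
      "(m + n - 1) div 2 - (m - n - 1) div 2 = n" if "odd (m + n)" for m n :: int
      using that by presburger+
    have F_sum: "F summable_on UNIV \<times> UNIV"
      unfolding F_def by (rule summable_on_Times_mult) (use l1 l2 in \<open>auto simp: has_sum_imp_summable\<close>)
    have F_sub: "F summable_on A" for A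
      by (rule summable_on_subset_banach[OF F_sum]) auto
    \<comment> \<open>If \<open>h\<close> parametrises \<open>A\<close> by pairs and the terms of
      \<open>F\<close> split along \<open>h\<close>, the sum over \<open>A\<close> is a product of
      two single sums.\<close>
    have F_factor: "infsum F A = infsum u UNIV * infsum v UNIV"
      if bij: "bij_betw h (UNIV \<times> UNIV) A" and uv: "\<And>s d. F (h (s, d)) = u s * v d"
      for h :: "int \<times> int \<Rightarrow> int \<times> int" and A and u v :: "int \<Rightarrow> complex"
    proof -
      have eq: "(\<lambda>z. F (h z)) = (\<lambda>(s, d). u s * v d)"
        using uv by auto
      have "infsum F A = infsum (\<lambda>(s, d). u s * v d) (UNIV \<times> UNIV)"
        using infsum_reindex_bij_betw[OF bij, of F] eq by simp
      also have "\<dots> = (\<Sum>\<^sub>\<infinity>s. \<Sum>\<^sub>\<infinity>d. u s * v d)"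
        using infsum_Sigma'_banach[of "\<lambda>s d. u s * v d" UNIV "\<lambda>_. UNIV"]
          summable_on_reindex_bij_betw[OF bij, of F] eq F_sub by simp
      finally show ?thesis
        by (simp add: infsum_cmult_right' infsum_cmult_left')
    qed
    have "theta (x * y) p * theta (x / y) p = infsum F (UNIV \<times> UNIV)"
      using F_factor[of id _ "\<lambda>n. ?d n * (x * y) powi n" "\<lambda>n. ?d n * (x / y) powi n"]
        infsumI[OF l1] infsumI[OF l2] by (simp add: F_def)
    also have "UNIV \<times> UNIV = E \<union> O'"
      by (auto simp: E_def O'_def)
    also have "infsum F (E \<union> O') = infsum F E + infsum F O'"
      by (rule infsum_Un_disjoint[OF F_sub F_sub]) (auto simp: E_def O'_def)
    also have "infsum F E = f0 x * g0 y"
      unfolding f0_def g0_def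
    proof (rule F_factor[of "\<lambda>(s, d). (s + d, s - d)"])
      show "bij_betw (\<lambda>(s, d). (s + d, s - d)) (UNIV \<times> UNIV) E"
        by (rule bij_betwI[of _ _ _ "\<lambda>(m, n). ((m + n) div 2, (m - n) div 2)"])
           (auto simp: E_def half)
      fix s d :: int
      have "((s + d) * (s + d - 1) + (s - d) * (s - d - 1)) = 2 * ((s * s - s) + d * d)"
        by (simp add: algebra_simps)
      then have e: "((s + d) * (s + d - 1) + (s - d) * (s - d - 1)) div 2 = (s * s - s) + d * d"
        by simp
      have "F (s + d, s - d) = (?d (s + d) * ?d (s - d)) * ((x * y) powi (s + d) * (x / y) powi (s - d))"
        by (simp add: F_def)
      also have "(x * y) powi (s + d) * (x / y) powi (s - d) = x powi (2 * s) * y powi (2 * d)"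
        using nz
        by (simp add: double power_int_add power_int_diff power_int_mult_distrib power_int_divide_distrib)
      also have "?d (s + d) * ?d (s - d) = c * (p powi (s * s - s) * p powi (d * d))"
        unfolding theta_coeff_mult e by (simp add: c_def power_int_add p_nz)
      finally show "F (case (s, d) of (s, d) \<Rightarrow> (s + d, s - d))
          = c * p powi (s * s - s) * x powi (2 * s) * (p powi (d * d) * y powi (2 * d))"
        by simp
    qed
    also have "infsum F O' = f1 x * g1 y"
      unfolding f1_def g1_def
    proof (rule F_factor[of "\<lambda>(s, d). (s + d + 1, s - d)"])
      show "bij_betw (\<lambda>(s, d). (s + d + 1, s - d)) (UNIV \<times> UNIV) O'"
        by (rule bij_betwI[of _ _ _ "\<lambda>(m, n). ((m + n - 1) div 2, (m - n - 1) div 2)"])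
           (auto simp: O'_def odd_half simp del: even_add odd_add)
      fix s d :: int
      have "((s + d + 1) * (s + d + 1 - 1) + (s - d) * (s - d - 1)) = 2 * (s * s + (d * d + d))"
        by (simp add: algebra_simps)
      then have e: "((s + d + 1) * (s + d + 1 - 1) + (s - d) * (s - d - 1)) div 2 = s * s + (d * d + d)"
        by simp
      have "F (s + d + 1, s - d)
          = (?d (s + d + 1) * ?d (s - d)) * ((x * y) powi (s + d + 1) * (x / y) powi (s - d))"
        by (simp add: F_def)
      also have "(x * y) powi (s + d + 1) * (x / y) powi (s - d) = x powi (2 * s + 1) * y powi (2 * d + 1)"
        using nz
        by (simp add: double power_int_add power_int_diff power_int_mult_distrib power_int_divide_distrib)
      also have "?d (s + d + 1) * ?d (s - d) = - c * (p powi (s * s) * p powi (d * d + d))"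
        unfolding theta_coeff_mult e by (simp add: c_def power_int_add p_nz)
      finally show "F (case (s, d) of (s, d) \<Rightarrow> (s + d + 1, s - d))
          = - c * p powi (s * s) * x powi (2 * s + 1) * (p powi (d * d + d) * y powi (2 * d + 1))"
        by simp
    qed
    finally show ?thesis .
  qed
  then show ?thesis
    by blast
qed

end

text \<open>The Pfaffian of an antisymmetric \<open>4 \<times> 4\<close> matrix squares to its determinant, which vanishes for rank two.\<close>

lemma rank_two_pfaffian:
  fixes \<phi> :: "complex \<Rightarrow> complex \<Rightarrow> complex"
  assumes rank: "\<And>x y. x \<in> A \<Longrightarrow> y \<in> A \<Longrightarrow> \<phi> x y = f0 x * g0 y + f1 x * g1 y"
    and anti: "\<And>x y. x \<in> A \<Longrightarrow> y \<in> A \<Longrightarrow> \<phi> y x = - \<phi> x y"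
    and A: "x \<in> A" "y \<in> A" "u \<in> A" "v \<in> A"
  shows "\<phi> x u * \<phi> y v = \<phi> x y * \<phi> u v + \<phi> x v * \<phi> y u"
proof -
  let ?P = "\<phi> x y * \<phi> u v - \<phi> x u * \<phi> y v + \<phi> x v * \<phi> y u"
  have diag: "\<phi> z z = 0" if "z \<in> A" for z
    using anti[OF that that] by simp
  have "?P * ?P = 0"
  proof -
    note r = rank[OF A(1) A(1)] rank[OF A(2) A(2)] rank[OF A(3) A(3)] rank[OF A(4) A(4)]
      rank[OF A(1) A(2)] rank[OF A(1) A(3)] rank[OF A(1) A(4)] rank[OF A(2) A(3)]
      rank[OF A(2) A(4)] rank[OF A(3) A(4)] rank[OF A(2) A(1)] rank[OF A(3) A(1)]
      rank[OF A(4) A(1)] rank[OF A(3) A(2)] rank[OF A(4) A(2)] rank[OF A(4) A(3)]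
    note a = anti[OF A(1) A(2)] anti[OF A(1) A(3)] anti[OF A(1) A(4)] anti[OF A(2) A(3)]
      anti[OF A(2) A(4)] anti[OF A(3) A(4)]
    note d = diag[OF A(1)] diag[OF A(2)] diag[OF A(3)] diag[OF A(4)]
    show ?thesis
      using r a d by algebra
  qed
  then have "?P = 0"
    by simp
  then show ?thesis
    by (simp add: algebra_simps)
qed

text \<open>After the factor \<open>1 - y\<close> is split off, what remains of
  \<open>theta y p\<close> is symmetric under \<open>y\<close> to \<open>1 / y\<close>; only
  \<open>1 - 1/x = - (1 - x) / x\<close> matters.\<close>

lemma theta_inverse:
  assumes "norm p < 1" and "x \<noteq> 0"
  shows "theta (1 / x) p = - theta x p / x"
proof (cases "p = 0")
  case True
  then show ?thesis
    using assms by (simp add: theta_nome_zero field_simps)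
next
  case False
  have step: "euler_series p y = (1 - y) * euler_series p (p * y)" for y
    by (rule euler_series_step[OF assms(1) False])
  have "theta y p = (1 - y) * (euler_series p (p * y) * euler_series p (p / y))" for y
    using theta_euler_series[OF assms(1) False, of y] step[of y] by simp
  from this[of x] this[of "1 / x"] show ?thesis
    using assms(2) by (simp add: divide_simps) (simp add: algebra_simps)
qed

lemma theta_weierstrass:
  assumes "norm p < 1" and nz: "x \<noteq> 0" "y \<noteq> 0" "u \<noteq> 0" "v \<noteq> 0"
  shows "theta (x * u) p * theta (x / u) p * theta (y * v) p * theta (y / v) p =
         theta (x * v) p * theta (x / v) p * theta (y * u) p * theta (y / u) p +
         y / u * theta (x * y) p * theta (x / y) p * theta (u * v) p * theta (u / v) p"
proof (cases "p = 0")
  case True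
  then show ?thesis
    using nz by (simp add: theta_nome_zero divide_simps) (simp add: algebra_simps)
next
  case False
  obtain f0 f1 g0 g1 where f: "theta (x * y) p * theta (x / y) p = f0 x * g0 y + f1 x * g1 y"
    if "x \<noteq> 0" "y \<noteq> 0" for x y
    using theta_rank_two[OF assms(1) False] by blast
  \<comment> \<open>Division by \<open>x\<close> absorbs the factor in \<open>theta_inverse\<close>,
    which turns it into antisymmetry.\<close>
  define \<phi> where "\<phi> x y = theta (x * y) p * theta (x / y) p / x" for x y
  have "\<phi> x u * \<phi> y v = \<phi> x y * \<phi> u v + \<phi> x v * \<phi> y u"
  proof (rule rank_two_pfaffian[of "- {0}"])
    fix x y :: complex assume xy: "x \<in> - {0}" "y \<in> - {0}"
    then show "\<phi> x y = (f0 x / x) * g0 y + (f1 x / x) * g1 y"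
      using f[of x y] by (simp add: \<phi>_def add_divide_distrib)
    show "\<phi> y x = - \<phi> x y"
      using xy theta_inverse[OF assms(1), of "x / y"] by (simp add: \<phi>_def mult.commute)
  qed (use nz in auto)
  then show ?thesis
    using nz by (simp add: \<phi>_def field_simps)
qed

text \<open>With \<open>X = q ^ m\<close> and \<open>Y = q ^ n\<close> this is
  \<open>N(XY) = N(X) + v N(Y)\<close> cleared of denominators.\<close>

lemma theta_addition:
  assumes "norm p < 1" and nz: "a \<noteq> 0" "b \<noteq> 0" "X \<noteq> 0" "Y \<noteq> 0"
  shows "theta (X * Y) p * theta (a * X * Y) p * theta (b * X) p * theta (a / b * X) p =
         theta X p * theta (a * X) p * theta (b * X * Y) p * theta (a / b * X * Y) p +
         X * theta (a * X\<^sup>2 * Y) p * theta Y p * theta b p * theta (a / b) p"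
proof -
  \<comment> \<open>The Weierstrass formula at \<open>(sXY, sX, s, s/b)\<close> with \<open>s^2 = a\<close>.\<close>
  define s where "s = csqrt a"
  have s: "a = s * s" "s \<noteq> 0"
    using nz power2_csqrt[of a] by (auto simp: s_def power2_eq_square)
  have "s * X * Y * s = a * X * Y" "s * X * Y / s = X * Y"
    "s * X * (s / b) = a / b * X" "s * X / (s / b) = b * X"
    "s * X * Y * (s / b) = a / b * X * Y" "s * X * Y / (s / b) = b * X * Y"
    "s * X * s = a * X" "s * X / s = X"
    "s * X * Y * (s * X) = a * X\<^sup>2 * Y" "s * X * Y / (s * X) = Y"
    "s * (s / b) = a / b" "s / (s / b) = b"
    using s nz by (simp_all add: power2_eq_square)
  note eqs = this
  have "s * X * Y \<noteq> 0" "s * X \<noteq> 0" "s \<noteq> 0" "s / b \<noteq> 0"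
    using s nz by auto
  from theta_weierstrass[OF assms(1) this] show ?thesis
    unfolding eqs by (simp only: mult_ac)
qed

section \<open>Tilings of regions by local rules\<close>

text \<open>For a fixed path all restrictions concern single tiles, so a predicate \<open>P\<close>
  on tiles suffices and is inherited when a tile is removed.\<close>

definition tilings :: "(tile \<Rightarrow> bool) \<Rightarrow> (nat \<times> nat) set \<Rightarrow> tile set set" where
  "tilings P R = {S. disjoint_family_on tile_cells S \<and> (\<Union>t\<in>S. tile_cells t) = R \<and> (\<forall>t\<in>S. P t)}"

definition tiling_sum :: "(tile \<Rightarrow> bool) \<Rightarrow> (tile \<Rightarrow> complex) \<Rightarrow> (nat \<times> nat) set \<Rightarrow> complex" where
  "tiling_sum P wt R = (\<Sum>S\<in>tilings P R. \<Prod>t\<in>S. wt t)"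

lemma tile_cells_nonempty: "tile_cells t \<noteq> {}"
  by (cases t) auto

lemma finite_tiles_within:
  assumes "finite R"
  shows "finite {t. tile_cells t \<subseteq> R}"
proof (rule finite_subset)
  show "{t. tile_cells t \<subseteq> R} \<subseteq> (\<lambda>(f, i, j). f i j) ` ({Mono, HDom, VDom} \<times> fst ` R \<times> snd ` R)"
  proof
    fix t assume "t \<in> {t. tile_cells t \<subseteq> R}"
    then show "t \<in> (\<lambda>(f, i, j). f i j) ` ({Mono, HDom, VDom} \<times> fst ` R \<times> snd ` R)"
      by (cases t) (force simp: image_iff)+
  qed
qed (use assms in auto)

lemma tilings_subset: "tilings P R \<subseteq> Pow {t. tile_cells t \<subseteq> R}"
  by (auto simp: tilings_def)

lemma finite_tilings: "finite R \<Longrightarrow> finite (tilings P R)"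
  by (rule finite_subset[OF tilings_subset]) (simp add: finite_tiles_within)

lemma finite_tiling: "finite R \<Longrightarrow> S \<in> tilings P R \<Longrightarrow> finite S"
  using tilings_subset finite_tiles_within by (metis PowD finite_subset in_mono)

lemma tilings_empty: "tilings P {} = {{}}"
  using tile_cells_nonempty by (auto simp: tilings_def disjoint_family_on_def)

lemma tiling_sum_empty: "tiling_sum P wt {} = 1"
  by (simp add: tiling_sum_def tilings_empty)

text \<open>This permits replacing a path by another one that imposes the same rules and weights on
  the tiles inside \<open>R\<close>.\<close>

lemma tiling_sum_cong:
  assumes "\<And>t. tile_cells t \<subseteq> R \<Longrightarrow> P t \<longleftrightarrow> P' t"
    and "\<And>t. tile_cells t \<subseteq> R \<Longrightarrow> P t \<Longrightarrow> wt t = wt' t"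
  shows "tiling_sum P wt R = tiling_sum P' wt' R"
proof -
  have "tilings P R = tilings P' R"
    using assms(1) by (auto simp: tilings_def)
  moreover have "(\<Prod>t\<in>S. wt t) = (\<Prod>t\<in>S. wt' t)" if "S \<in> tilings P R" for S
    using that by (intro prod.cong refl assms(2)) (auto simp: tilings_def)
  ultimately show ?thesis
    by (simp add: tiling_sum_def)
qed

lemma insert_tiling:
  assumes "S \<in> tilings P (R - tile_cells t)" and "P t" and "tile_cells t \<subseteq> R"
  shows "insert t S \<in> tilings P R"
proof -
  have "tile_cells s \<inter> tile_cells t = {}" if "s \<in> S" for s
    using assms(1) that by (auto simp: tilings_def)
  then have "disjoint_family_on tile_cells (insert t S)"
    using assms(1) by (auto simp: tilings_def disjoint_family_on_def)
  then show ?thesis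
    using assms by (auto simp: tilings_def)
qed

lemma tiling_remove:
  assumes "S \<in> tilings P R" and "t \<in> S"
  shows "S - {t} \<in> tilings P (R - tile_cells t)"
proof -
  have dis: "disjoint_family_on tile_cells S"
    using assms by (simp add: tilings_def)
  then have "tile_cells s \<inter> tile_cells t = {}" if "s \<in> S - {t}" for s
    using assms(2) that by (auto simp: disjoint_family_on_def)
  moreover have "disjoint_family_on tile_cells (S - {t})"
    by (rule disjoint_family_on_mono[OF _ dis]) auto
  ultimately show ?thesis
    using assms by (auto simp: tilings_def)
qed

text \<open>Exactly one tile covers \<open>c\<close>. Sorting the tilings by this tile and removing
  it leaves arbitrary tilings of the remaining cells.\<close>

lemma tiling_sum_peel:
  assumes "finite R" and "c \<in> R"
  shows "tiling_sum P wt R =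
    (\<Sum>t\<in>{t. P t \<and> c \<in> tile_cells t \<and> tile_cells t \<subseteq> R}. wt t * tiling_sum P wt (R - tile_cells t))"
proof -
  let ?A = "{t. P t \<and> c \<in> tile_cells t \<and> tile_cells t \<subseteq> R}"
  let ?B = "\<lambda>t. insert t ` tilings P (R - tile_cells t)"
  have notin: "t \<notin> S" if "S \<in> tilings P (R - tile_cells t)" for t S
    using that tile_cells_nonempty[of t] by (auto simp: tilings_def)
  have union: "tilings P R = (\<Union>t\<in>?A. ?B t)"
  proof
    show "tilings P R \<subseteq> (\<Union>t\<in>?A. ?B t)"
    proof
      fix S assume S: "S \<in> tilings P R"
      then obtain t where t: "t \<in> S" "c \<in> tile_cells t"
        using assms(2) by (auto simp: tilings_def)
      then have "t \<in> ?A"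
        using S by (auto simp: tilings_def)
      moreover have "S \<in> ?B t"
        using tiling_remove[OF S t(1)] t(1) by (intro image_eqI[of _ _ "S - {t}"]) auto
      ultimately show "S \<in> (\<Union>t\<in>?A. ?B t)"
        by blast
    qed
  qed (auto intro: insert_tiling)
  have "tiling_sum P wt R = (\<Sum>t\<in>?A. \<Sum>S\<in>?B t. \<Prod>t\<in>S. wt t)"
    unfolding tiling_sum_def union
  proof (rule sum.UNION_disjoint)
    show "finite ?A"
      by (rule finite_subset[OF _ finite_tiles_within[OF assms(1)]]) auto
    show "\<forall>t\<in>?A. finite (?B t)"
      using assms(1) by (simp add: finite_tilings)
    show "\<forall>t\<in>?A. \<forall>t'\<in>?A. t \<noteq> t' \<longrightarrow> ?B t \<inter> ?B t' = {}"
    proof (intro ballI impI)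
      fix t t' assume t: "t \<in> ?A" "t' \<in> ?A" "t \<noteq> t'"
      show "?B t \<inter> ?B t' = {}"
      proof (rule ccontr)
        assume "?B t \<inter> ?B t' \<noteq> {}"
        then obtain S where S: "S \<in> ?B t" "S \<in> ?B t'"
          by blast
        then have "S \<in> tilings P R"
          using union t by blast
        moreover have "t \<in> S" "t' \<in> S"
          using S by auto
        ultimately show False
          using t by (auto simp: tilings_def disjoint_family_on_def)
      qed
    qed
  qed
  also have "\<dots> = (\<Sum>t\<in>?A. wt t * tiling_sum P wt (R - tile_cells t))"
  proof (rule sum.cong[OF refl])
    fix t
    have inj: "inj_on (insert t) (tilings P (R - tile_cells t))"
      using notin by (intro inj_onI) (metis insert_ident)
    have "(\<Sum>S\<in>?B t. \<Prod>t\<in>S. wt t) = (\<Sum>S\<in>tilings P (R - tile_cells t). \<Prod>t\<in>insert t S. wt t)"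
      by (simp add: sum.reindex[OF inj])
    also have "\<dots> = (\<Sum>S\<in>tilings P (R - tile_cells t). wt t * (\<Prod>t\<in>S. wt t))"
      using notin assms(1) by (intro sum.cong refl prod.insert finite_tiling[of "R - tile_cells t"]) auto
    finally show "(\<Sum>S\<in>?B t. \<Prod>t\<in>S. wt t) = wt t * tiling_sum P wt (R - tile_cells t)"
      by (simp add: tiling_sum_def sum_distrib_left)
  qed
  finally show ?thesis .
qed

text \<open>The total weight of a strip of \<open>k\<close> cells tiled by monominos of weight 1 and
  dominos, where \<open>f k\<close> is the weight of a domino whose last cell is number
  \<open>k\<close>.\<close>

fun strip_sum :: "(nat \<Rightarrow> complex) \<Rightarrow> nat \<Rightarrow> complex" where
  "strip_sum f 0 = 1"
| "strip_sum f (Suc 0) = 1"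
| "strip_sum f (Suc (Suc k)) = strip_sum f (Suc k) + f (Suc (Suc k)) * strip_sum f k"

text \<open>The map \<open>c\<close> enumerates a row or a column attached to a region
  \<open>A\<close>. By \<open>tiles\<close> its last cell is covered only from within the strip, so
  peeling that cell reproduces the recursion of \<open>strip_sum\<close>.\<close>

lemma tiling_sum_strip:
  fixes c :: "nat \<Rightarrow> nat \<times> nat" and mn dm :: "nat \<Rightarrow> tile"
  assumes fin: "finite A" and inj: "inj_on c {1..K}" and new: "c ` {1..K} \<inter> A = {}"
    and mono: "\<And>k. k \<in> {1..K} \<Longrightarrow> tile_cells (mn k) = {c k} \<and> wt (mn k) = 1"
    and dom: "\<And>k. k \<in> {2..K} \<Longrightarrow> tile_cells (dm k) = {c (k - 1), c k} \<and> wt (dm k) = f k"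
    and tiles: "\<And>k. k \<in> {1..K} \<Longrightarrow>
      {t. P t \<and> c k \<in> tile_cells t \<and> tile_cells t \<subseteq> A \<union> c ` {1..k}} =
      {mn k} \<union> (if 2 \<le> k then {dm k} else {})"
    and "k \<le> K"
  shows "tiling_sum P wt (A \<union> c ` {1..k}) = strip_sum f k * tiling_sum P wt A"
  using \<open>k \<le> K\<close>
proof (induction k rule: induct_nat_012)
  case 0
  then show ?case by simp
next
  case 1
  then have 1: "1 \<in> {1..K}" by simp
  then have "c 1 \<notin> A"
    using new by blast
  then have "A \<union> c ` {1..Suc 0} - tile_cells (mn 1) = A"
    using mono[OF 1] by auto
  moreover have "c 1 \<in> A \<union> c ` {1..Suc 0}"
    by simp
  ultimately show ?case
    using tiling_sum_peel[of "A \<union> c ` {1..Suc 0}" "c 1" P wt] fin tiles[OF 1] mono[OF 1] by simp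
next
  case (ge2 k)
  let ?k = "Suc (Suc k)"
  have k: "?k \<in> {1..K}" "?k \<in> {2..K}"
    using ge2 by auto
  have neq: "c (Suc k) \<noteq> c ?k" "c ?k \<noteq> c (Suc k)"
    using inj_onD[OF inj, of "Suc k" ?k] k by auto
  have "c i \<notin> A" if "i \<in> {1..K}" for i
    using new that by blast
  from this[of ?k] this[of "Suc k"] have notin: "c ?k \<notin> A" "c (Suc k) \<notin> A"
    using k by auto
  have "c i \<noteq> c ?k" if "i \<in> {1..Suc k}" for i
    using inj_onD[OF inj, of i ?k] k that by auto
  then have r1: "A \<union> c ` {1..?k} - tile_cells (mn ?k) = A \<union> c ` {1..Suc k}"
    using mono[OF k(1)] notin neq by (auto simp: atLeastAtMostSuc_conv)
  have "c i \<noteq> c ?k \<and> c i \<noteq> c (Suc k)" if "i \<in> {1..k}" for i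
    using inj_onD[OF inj, of i ?k] inj_onD[OF inj, of i "Suc k"] k that by auto
  then have r2: "A \<union> c ` {1..?k} - tile_cells (dm ?k) = A \<union> c ` {1..k}"
    using dom[OF k(2)] notin by (auto simp: atLeastAtMostSuc_conv)
  have "mn ?k \<noteq> dm ?k"
    using mono[OF k(1)] dom[OF k(2)] neq by (metis diff_Suc_1 insertI1 singletonD)
  moreover have "c ?k \<in> A \<union> c ` {1..?k}"
    by simp
  ultimately show ?case
    using tiling_sum_peel[of "A \<union> c ` {1..?k}" "c ?k" P wt] fin tiles[OF k(1)]
      mono[OF k(1)] dom[OF k(2)] r1 r2 ge2 by (simp add: algebra_simps)
qed

section \<open>Removing the last step of the path\<close>

lemma east_steps_Nil [simp]: "east_steps [] = {}"
  by (simp add: east_steps_def)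

lemma east_steps_snoc:
  "east_steps (w @ [s]) = (if s = East
     then insert (Suc (count_list w East), count_list w North) (east_steps w) else east_steps w)"
proof -
  have *: "(k < length (w @ [s]) \<and> (w @ [s]) ! k = East) \<longleftrightarrow>
      (k < length w \<and> w ! k = East) \<or> (k = length w \<and> s = East)" for k
    by (auto simp: nth_append less_Suc_eq)
  have "east_steps (w @ [s]) = {path_pos (w @ [s]) (Suc k) |k. k < length w \<and> w ! k = East} \<union>
      {path_pos (w @ [s]) (Suc k) |k. k = length w \<and> s = East}"
    unfolding east_steps_def * by blast
  also have "{path_pos (w @ [s]) (Suc k) |k. k < length w \<and> w ! k = East} = east_steps w"
    unfolding east_steps_def path_pos_def by (intro Collect_cong ex_cong1) auto
  finally show ?thesis
    by (auto simp: path_pos_def)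
qed

lemma east_steps_bounds:
  "(i, h) \<in> east_steps w \<Longrightarrow> i \<in> {1..count_list w East} \<and> h \<le> count_list w North"
  by (induction w rule: rev_induct) (auto simp: east_steps_snoc split: if_splits)

lemma east_steps_ex: "i \<in> {1..count_list w East} \<Longrightarrow> \<exists>h. (i, h) \<in> east_steps w"
proof (induction w rule: rev_induct)
  case (snoc s w)
  then show ?case
    by (cases s; cases "i = Suc (count_list w East)") (auto simp: east_steps_snoc)
qed simp

text \<open>The conditions of \<open>path_domino_tilings\<close> for a single tile, which brings
  them into the form required by \<open>tilings\<close>.\<close>

definition admissible :: "step list \<Rightarrow> tile \<Rightarrow> bool" where
  "admissible w t \<longleftrightarrow> (tile_above w t \<or> tile_below w t) \<and>
     (tile_above w t \<longrightarrow> (\<exists>i j. t = Mono i j \<or> t = HDom i j)) \<and>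
     (tile_below w t \<longrightarrow> (\<exists>i j. t = Mono i j \<or> t = VDom i j)) \<and>
     (touches_from_below w t \<longrightarrow> (\<exists>i j. t = VDom i j))"

definition path_tiling_sum ::
    "complex \<Rightarrow> complex \<Rightarrow> complex \<Rightarrow> complex \<Rightarrow> nat \<Rightarrow> nat \<Rightarrow> step list \<Rightarrow> complex" where
  "path_tiling_sum a b q p m n w =
     tiling_sum (admissible w) (tile_weight a b q p w) ({1..m} \<times> {1..n})"

lemma path_domino_tilings_Sigma:
  "path_domino_tilings m n = Sigma (lattice_paths m n) (\<lambda>w. tilings (admissible w) ({1..m} \<times> {1..n}))"
  by (auto simp: path_domino_tilings_def tilings_def is_tiling_def admissible_def)

lemma finite_lattice_paths: "finite (lattice_paths m n)"
proof -
  have "length w = count_list w East + count_list w North" for w :: "step list"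
  proof (induction w)
    case (Cons s w)
    then show ?case by (cases s) auto
  qed simp
  moreover have "(UNIV :: step set) = {North, East}"
    using step.exhaust by blast
  ultimately have "lattice_paths m n \<subseteq> {w. set w \<subseteq> {North, East} \<and> length w = m + n}"
    by (auto simp: lattice_paths_def)
  then show ?thesis
    by (rule finite_subset) (simp add: finite_lists_length_eq)
qed

lemma elliptic_weight_sum:
  "(\<Sum>T\<in>path_domino_tilings m n. elliptic_weight a b q p T) =
     (\<Sum>w\<in>lattice_paths m n. path_tiling_sum a b q p m n w)"
  unfolding path_domino_tilings_Sigma path_tiling_sum_def tiling_sum_def elliptic_weight_def
  by (subst sum.Sigma) (simp_all add: finite_lattice_paths finite_tilings split_def)

lemma lattice_paths_Suc_Suc:
  "lattice_paths (Suc m) (Suc n) =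
     (\<lambda>w. w @ [North]) ` lattice_paths (Suc m) n \<union> (\<lambda>w. w @ [East]) ` lattice_paths m (Suc n)"
proof
  show "lattice_paths (Suc m) (Suc n) \<subseteq>
     (\<lambda>w. w @ [North]) ` lattice_paths (Suc m) n \<union> (\<lambda>w. w @ [East]) ` lattice_paths m (Suc n)"
  proof
    fix w assume w: "w \<in> lattice_paths (Suc m) (Suc n)"
    show "w \<in> (\<lambda>w. w @ [North]) ` lattice_paths (Suc m) n \<union> (\<lambda>w. w @ [East]) ` lattice_paths m (Suc n)"
    proof (cases w rule: rev_cases)
      case (snoc v s)
      then show ?thesis
        using w by (cases s) (auto simp: lattice_paths_def)
    qed (use w in \<open>simp add: lattice_paths_def\<close>)
  qed
qed (auto simp: lattice_paths_def)

text \<open>A path enters the tile conditions only through its east steps, and a final north step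
  adds none.\<close>

lemma admissible_snoc_North: "admissible (w @ [North]) = admissible w"
  by (simp add: fun_eq_iff admissible_def tile_above_def tile_below_def cell_above_def cell_below_def
      touches_from_below_def east_steps_snoc)

lemma tile_weight_snoc_North: "tile_weight a b q p (w @ [North]) = tile_weight a b q p w"
proof
  fix t show "tile_weight a b q p (w @ [North]) t = tile_weight a b q p w t"
    by (cases t) (simp_all add: tile_below_def cell_below_def touches_from_below_def east_steps_snoc)
qed

lemma top_right_in_tile_cells: "top_right t \<in> tile_cells t"
  by (cases t) auto

text \<open>The new east step belongs to column \<open>Suc m\<close>, which no tile within the first
  \<open>m\<close> columns meets.\<close>

lemma snoc_East_within:
  assumes "w \<in> lattice_paths m n" and "tile_cells t \<subseteq> {1..m} \<times> B"
  shows "admissible (w @ [East]) t \<longleftrightarrow> admissible w t"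
    and "tile_weight a b q p (w @ [East]) t = tile_weight a b q p w t"
proof -
  have m: "count_list w East = m"
    using assms(1) by (simp add: lattice_paths_def)
  have "cell_above (w @ [East]) c \<longleftrightarrow> cell_above w c" "cell_below (w @ [East]) c \<longleftrightarrow> cell_below w c"
    if "c \<in> tile_cells t" for c
    using that assms(2) by (auto simp: cell_above_def cell_below_def east_steps_snoc m)
  then have *: "tile_above (w @ [East]) t \<longleftrightarrow> tile_above w t" "tile_below (w @ [East]) t \<longleftrightarrow> tile_below w t"
    by (simp_all add: tile_above_def tile_below_def)
  have "fst (top_right t) \<noteq> Suc m"
    using top_right_in_tile_cells[of t] assms(2) by auto
  then have **: "touches_from_below (w @ [East]) t \<longleftrightarrow> touches_from_below w t"
    by (auto simp: touches_from_below_def * east_steps_snoc m)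
  show "admissible (w @ [East]) t \<longleftrightarrow> admissible w t"
    by (simp add: admissible_def * **)
  show "tile_weight a b q p (w @ [East]) t = tile_weight a b q p w t"
    using ** by (cases t) simp_all
qed

text \<open>Before its final step the path stays at height at most \<open>n\<close>, so the whole
  top row lies above it. Only monominos and horizontal dominos are allowed there, and the row splits
  off as a strip.\<close>

lemma path_tiling_sum_North:
  assumes w: "w \<in> lattice_paths m n"
  shows "path_tiling_sum a b q p m (Suc n) (w @ [North]) =
    strip_sum (\<lambda>i. omega1 a b q p i (Suc n)) m * path_tiling_sum a b q p m n w"
proof -
  have cnt: "count_list w East = m" "count_list w North = n"
    using w by (simp_all add: lattice_paths_def)
  have above: "cell_above w (i, Suc n)" "\<not> cell_below w (i, Suc n)" if "i \<in> {1..m}" for i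
    using east_steps_ex[of i w] east_steps_bounds[of i _ w] that
    by (force simp: cell_above_def cell_below_def cnt)+
  let ?A = "{1..m} \<times> {1..n}"
  have eq: "{1..m} \<times> {1..Suc n} = ?A \<union> (\<lambda>i. (i, Suc n)) ` {1..m}"
    by auto
  have "tiling_sum (admissible w) (tile_weight a b q p w) (?A \<union> (\<lambda>i. (i, Suc n)) ` {1..m}) =
    strip_sum (\<lambda>i. omega1 a b q p i (Suc n)) m * tiling_sum (admissible w) (tile_weight a b q p w) ?A"
  proof (rule tiling_sum_strip[where mn = "\<lambda>i. Mono i (Suc n)" and dm = "\<lambda>i. HDom i (Suc n)" and K = m])
    fix k assume k: "k \<in> {1..m}"
    show "{t. admissible w t \<and> (k, Suc n) \<in> tile_cells t \<and>
          tile_cells t \<subseteq> ?A \<union> (\<lambda>i. (i, Suc n)) ` {1..k}} =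
        {Mono k (Suc n)} \<union> (if 2 \<le> k then {HDom k (Suc n)} else {})" (is "?L = ?R")
    proof
      show "?L \<subseteq> ?R"
      proof
        fix t assume t: "t \<in> ?L"
        then have "\<not> tile_below w t"
          using above[OF k] by (auto simp: tile_below_def)
        then obtain i j where "t = Mono i j \<or> t = HDom i j"
          using t by (auto simp: admissible_def)
        then show "t \<in> ?R"
          using t by auto
      qed
      have "admissible w (Mono k (Suc n))"
        using above[OF k]
        by (auto simp: admissible_def tile_above_def tile_below_def touches_from_below_def)
      moreover have "admissible w (HDom k (Suc n))" if "2 \<le> k"
      proof -
        have "k - 1 \<in> {1..m}"
          using k that by auto
        from above[OF k] above[OF this] show ?thesis
          by (auto simp: admissible_def tile_above_def tile_below_def touches_from_below_def)
      qed
      ultimately show "?R \<subseteq> ?L"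
        using k by (auto split: if_splits)
    qed
  qed (auto simp: inj_on_def)
  then show ?thesis
    unfolding path_tiling_sum_def admissible_snoc_North tile_weight_snoc_North eq .
qed

text \<open>The last column lies entirely below the path. A special vertical domino must cover its
  top two cells, and the \<open>n - 2\<close> cells under it form a strip with transposed
  weights.\<close>

lemma path_tiling_sum_East:
  assumes w: "w \<in> lattice_paths m n" and "n \<ge> 1"
  shows "path_tiling_sum a b q p (Suc m) n (w @ [East]) =
    (if n = 1 then 0 else omega2 a b q p (Suc m) n * strip_sum (\<lambda>j. omega1 a b q p j (Suc m)) (n - 2)) *
    path_tiling_sum a b q p m n w"
proof -
  let ?w = "w @ [East]"
  let ?A = "{1..m} \<times> {1..n}"
  let ?ts = "tiling_sum (admissible ?w) (tile_weight a b q p ?w)"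
  have cnt: "count_list w East = m" "count_list w North = n"
    using w by (simp_all add: lattice_paths_def)
  have top: "(Suc m, h) \<in> east_steps ?w \<longleftrightarrow> h = n" for h
    using east_steps_bounds[of "Suc m" h w] by (auto simp: east_steps_snoc cnt)
  then have below: "\<not> cell_above ?w (Suc m, j)" "cell_below ?w (Suc m, j)" if "j \<le> n" for j
    using that by (auto simp: cell_above_def cell_below_def)
  have not_HDom: "\<exists>i j. t = Mono i j \<or> t = VDom i j"
    if "admissible ?w t" "(Suc m, j) \<in> tile_cells t" "j \<le> n" for t j
    using that below[of j] by (auto simp: admissible_def tile_above_def)
  have eq: "{1..Suc m} \<times> {1..n} = ?A \<union> (\<lambda>j. (Suc m, j)) ` {1..n}"
    by auto
  have touch: "touches_from_below ?w (VDom (Suc m) j) \<longleftrightarrow> j = n" if "j \<le> n" for j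
    using that below top by (auto simp: touches_from_below_def tile_below_def)
  have mono_touch: "touches_from_below ?w (Mono (Suc m) j) \<longleftrightarrow> j = n" if "j \<le> n" for j
    using that below top by (auto simp: touches_from_below_def tile_below_def)
  have adm_VDom: "admissible ?w (VDom (Suc m) j)" if "j \<le> n" for j
    using that below by (auto simp: admissible_def tile_above_def tile_below_def)
  have adm_Mono: "admissible ?w (Mono (Suc m) j) \<longleftrightarrow> j < n" if "j \<le> n" for j
    using that below mono_touch[OF that] by (auto simp: admissible_def tile_above_def tile_below_def)
  have strip: "?ts (?A \<union> (\<lambda>j. (Suc m, j)) ` {1..n - 2}) =
      strip_sum (\<lambda>j. omega1 a b q p j (Suc m)) (n - 2) * ?ts ?A"
  proof (rule tiling_sum_strip[where mn = "Mono (Suc m)" and dm = "VDom (Suc m)" and K = "n - 2"])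
    fix k assume k: "k \<in> {1..n - 2}"
    show "{t. admissible ?w t \<and> (Suc m, k) \<in> tile_cells t \<and>
          tile_cells t \<subseteq> ?A \<union> Pair (Suc m) ` {1..k}} =
        {Mono (Suc m) k} \<union> (if 2 \<le> k then {VDom (Suc m) k} else {})" (is "?L = ?R")
    proof
      show "?L \<subseteq> ?R"
      proof
        fix t assume t: "t \<in> ?L"
        have "k \<le> n"
          using k by auto
        then obtain i j where "t = Mono i j \<or> t = VDom i j"
          using t not_HDom[of t k] by blast
        then show "t \<in> ?R"
          using t by auto
      qed
      show "?R \<subseteq> ?L"
        using k adm_Mono[of k] adm_VDom[of k] by (auto split: if_splits)
    qed
  qed (auto simp: inj_on_def touch)
  have base: "?ts ?A = path_tiling_sum a b q p m n w"
    unfolding path_tiling_sum_def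
    by (rule tiling_sum_cong) (use snoc_East_within[OF w] in auto)
  have "?ts ({1..Suc m} \<times> {1..n}) =
    (\<Sum>t\<in>{t. admissible ?w t \<and> (Suc m, n) \<in> tile_cells t \<and> tile_cells t \<subseteq> {1..Suc m} \<times> {1..n}}.
       tile_weight a b q p ?w t * ?ts ({1..Suc m} \<times> {1..n} - tile_cells t))"
    by (rule tiling_sum_peel) (use assms(2) in auto)
  \<comment> \<open>A monomino at height \<open>n\<close> would touch the path from below. For
    \<open>n = 1\<close> the domino would need a cell at height 0, so no tile fits.\<close>
  also have "{t. admissible ?w t \<and> (Suc m, n) \<in> tile_cells t \<and> tile_cells t \<subseteq> {1..Suc m} \<times> {1..n}} =
    (if n = 1 then {} else {VDom (Suc m) n})" (is "?L = ?R")
  proof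
    show "?L \<subseteq> ?R"
    proof
      fix t assume t: "t \<in> ?L"
      then obtain i j where "t = Mono i j \<or> t = VDom i j"
        using not_HDom[of t n] by auto
      then show "t \<in> ?R"
        using t adm_Mono[of n] by auto
    qed
    show "?R \<subseteq> ?L"
      using assms(2) adm_VDom[of n] by auto
  qed
  also have "(\<Sum>t\<in>(if n = 1 then {} else {VDom (Suc m) n}).
       tile_weight a b q p ?w t * ?ts ({1..Suc m} \<times> {1..n} - tile_cells t)) =
    (if n = 1 then 0 else omega2 a b q p (Suc m) n * strip_sum (\<lambda>j. omega1 a b q p j (Suc m)) (n - 2)) *
    ?ts ?A"
  proof (cases "n = 1")
    case False
    have "(\<lambda>j. (Suc m, j)) ` {1..n - 2} = {Suc m} \<times> {1..n - 2}"
      by auto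
    then have "{1..Suc m} \<times> {1..n} - tile_cells (VDom (Suc m) n) = ?A \<union> (\<lambda>j. (Suc m, j)) ` {1..n - 2}"
      using False assms(2) by auto
    then show ?thesis
      using False strip touch[of n] by simp
  qed simp
  finally show ?thesis
    unfolding base path_tiling_sum_def[of a b q p "Suc m"] .
qed

section \<open>Recurrence and initial values of the tiling sums\<close>

definition path_domino_sum :: "complex \<Rightarrow> complex \<Rightarrow> complex \<Rightarrow> complex \<Rightarrow> nat \<Rightarrow> nat \<Rightarrow> complex" where
  "path_domino_sum a b q p m n = (\<Sum>T\<in>path_domino_tilings m n. elliptic_weight a b q p T)"

text \<open>The paths are sorted by their last step. The height is \<open>Suc n\<close> here, so
  \<open>n - 1\<close> cells remain under the special domino, and the second term is absent at
  height 1.\<close>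

lemma path_domino_sum_Suc_Suc:
  "path_domino_sum a b q p (Suc m) (Suc n) =
    strip_sum (\<lambda>i. omega1 a b q p i (Suc n)) (Suc m) * path_domino_sum a b q p (Suc m) n +
    (if n = 0 then 0 else omega2 a b q p (Suc m) (Suc n) * strip_sum (\<lambda>j. omega1 a b q p j (Suc m)) (n - 1)) *
    path_domino_sum a b q p m (Suc n)"
proof -
  let ?Z = "path_tiling_sum a b q p"
  have "path_domino_sum a b q p (Suc m) (Suc n) =
      (\<Sum>w\<in>(\<lambda>w. w @ [North]) ` lattice_paths (Suc m) n. ?Z (Suc m) (Suc n) w) +
      (\<Sum>w\<in>(\<lambda>w. w @ [East]) ` lattice_paths m (Suc n). ?Z (Suc m) (Suc n) w)"
    unfolding path_domino_sum_def elliptic_weight_sum lattice_paths_Suc_Suc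
    by (rule sum.union_disjoint) (auto simp: finite_lattice_paths)
  also have "\<dots> = (\<Sum>w\<in>lattice_paths (Suc m) n. ?Z (Suc m) (Suc n) (w @ [North])) +
      (\<Sum>w\<in>lattice_paths m (Suc n). ?Z (Suc m) (Suc n) (w @ [East]))"
    by (simp add: sum.reindex inj_on_def)
  finally show ?thesis
    unfolding path_domino_sum_def elliptic_weight_sum sum_distrib_left
    by (simp add: path_tiling_sum_North path_tiling_sum_East)
qed

lemma lattice_paths_0: "lattice_paths 0 n = {replicate n North}" "lattice_paths m 0 = {replicate m East}"
proof -
  have *: "count_list (replicate k (s :: step)) t = (if s = t then k else 0)" for k s t
    by (induction k) auto
  have "w = replicate (count_list w North) North" if "count_list w East = 0" for w
    using that by (induction w) (auto split: if_splits intro: step.exhaust)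
  then show "lattice_paths 0 n = {replicate n North}"
    by (auto simp: lattice_paths_def *)
  have "w = replicate (count_list w East) East" if "count_list w North = 0" for w
    using that by (induction w) (auto split: if_splits intro: step.exhaust)
  then show "lattice_paths m 0 = {replicate m East}"
    by (auto simp: lattice_paths_def *)
qed

lemma path_domino_sum_0:
  "path_domino_sum a b q p 0 n = 1" "path_domino_sum a b q p m 0 = 1"
  by (simp_all add: path_domino_sum_def elliptic_weight_sum lattice_paths_0 path_tiling_sum_def tiling_sum_empty)

section \<open>Tiles that occur in path-domino tilings\<close>

lemma east_steps_replicate_North: "east_steps (w @ replicate k North) = east_steps w"
proof (induction k)
  case (Suc k)
  have "w @ replicate (Suc k) North = (w @ replicate k North) @ [North]"
    by (simp add: replicate_append_same)
  then show ?case
    using Suc by (simp only: east_steps_snoc) simp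
qed simp

lemma count_list_replicate: "count_list (replicate k s) t = (if s = t then k else 0)"
  by (induction k) auto

lemma east_steps_replicate_East:
  "east_steps (w @ replicate k East) =
     east_steps w \<union> {Suc (count_list w East)..count_list w East + k} \<times> {count_list w North}"
proof (induction k)
  case (Suc k)
  have "w @ replicate (Suc k) East = (w @ replicate k East) @ [East]"
    by (simp add: replicate_append_same)
  then have "east_steps (w @ replicate (Suc k) East) =
      insert (Suc (count_list w East + k), count_list w North) (east_steps (w @ replicate k East))"
    by (simp only: east_steps_snoc) (simp add: count_list_replicate)
  then show ?case
    using Suc by (auto simp del: replicate_Suc)
qed simp

text \<open>A monomino is forbidden only directly under an east step. Once \<open>S\<close> covers
  those cells, all others can be filled with monominos.\<close>

lemma extend_by_monominos:
  assumes w: "w \<in> lattice_paths m n" and dis: "disjoint_family_on tile_cells S"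
    and adm: "\<And>t. t \<in> S \<Longrightarrow> admissible w t \<and> tile_cells t \<subseteq> {1..m} \<times> {1..n}"
    and steps: "east_steps w \<inter> {1..m} \<times> {1..n} \<subseteq> (\<Union>t\<in>S. tile_cells t)"
  shows "\<exists>S'. (w, S') \<in> path_domino_tilings m n \<and> S \<subseteq> S'"
proof -
  let ?R = "{1..m} \<times> {1..n} - (\<Union>t\<in>S. tile_cells t)"
  let ?M = "(\<lambda>(i, j). Mono i j) ` ?R"
  have "admissible w (Mono i j)" if ij: "(i, j) \<in> ?R" for i j
  proof -
    obtain h where h: "(i, h) \<in> east_steps w"
      using east_steps_ex[of i w] ij w by (auto simp: lattice_paths_def)
    have "(i, j) \<notin> east_steps w"
      using ij steps by blast
    then show ?thesis
      using h by (auto simp: admissible_def tile_above_def tile_below_def cell_above_def cell_below_def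
          touches_from_below_def not_le)
  qed
  moreover have "disjoint_family_on tile_cells (S \<union> ?M)"
    using dis by (auto simp: disjoint_family_on_def)
  moreover have "(\<Union>t\<in>S \<union> ?M. tile_cells t) = {1..m} \<times> {1..n}"
  proof -
    have "(\<Union>t\<in>?M. tile_cells t) = ?R"
      by auto
    moreover have "(\<Union>t\<in>S. tile_cells t) \<subseteq> {1..m} \<times> {1..n}"
      using adm by blast
    ultimately show ?thesis
      unfolding UN_Un by (simp only: Un_Diff_cancel Un_absorb1)
  qed
  ultimately have "S \<union> ?M \<in> tilings (admissible w) ({1..m} \<times> {1..n})"
    using adm by (auto simp: tilings_def)
  then show ?thesis
    using w by (auto simp: path_domino_tilings_Sigma)
qed

text \<open>For the path along the bottom and right sides every cell lies above the path and no tile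
  is forced.\<close>

lemma HDom_occurs:
  assumes "i \<in> {2..m}" and "j \<in> {1..n}"
  obtains w S where "(w, S) \<in> path_domino_tilings m n" and "HDom i j \<in> S"
proof -
  define w where "w = replicate m East @ replicate n North"
  have steps: "east_steps w = {1..m} \<times> {0}"
    using east_steps_replicate_East[of "[]" m] by (simp add: w_def east_steps_replicate_North)
  have "w \<in> lattice_paths m n"
    by (simp add: w_def lattice_paths_def count_list_replicate)
  moreover have "admissible w (HDom i j)"
    using assms by (auto simp: admissible_def tile_above_def tile_below_def cell_above_def cell_below_def
        touches_from_below_def steps)
  ultimately have "\<exists>S'. (w, S') \<in> path_domino_tilings m n \<and> {HDom i j} \<subseteq> S'"
    using assms by (intro extend_by_monominos) (auto simp: steps disjoint_family_on_def)
  then show ?thesis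
    using that by auto
qed

text \<open>The path follows the bottom up to column \<open>i - 1\<close>, climbs to height
  \<open>j\<close> and crosses all remaining columns there. Special dominos are then forced in
  columns \<open>i\<close> to \<open>m\<close>, and they all end at height \<open>j\<close>.\<close>

lemma special_VDom_occurs:
  assumes "i \<in> {1..m}" and "j \<in> {2..n}"
  obtains w S where "(w, S) \<in> path_domino_tilings m n" and "VDom i j \<in> S"
    and "touches_from_below w (VDom i j)"
proof -
  define w where
    "w = ((replicate (i - 1) East @ replicate j North) @ replicate (m - (i - 1)) East) @ replicate (n - j) North"
  have "Suc (i - 1) = i" "i - 1 + (m - (i - 1)) = m"
    using assms by auto
  moreover have "east_steps (replicate (i - 1) East) = {1..i - 1} \<times> {0}"
    using east_steps_replicate_East[of "[]" "i - 1"] by simp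
  ultimately have steps: "east_steps w = {1..i - 1} \<times> {0} \<union> {i..m} \<times> {j}"
    unfolding w_def east_steps_replicate_North east_steps_replicate_East
    by (simp only: count_list_append count_list_replicate step.simps simp_thms if_True if_False
        add_0 add_0_right)
  have "w \<in> lattice_paths m n"
    using assms by (auto simp: w_def lattice_paths_def count_list_replicate)
  moreover have "admissible w (VDom i' j)" if "i' \<in> {i..m}" for i'
    using assms that by (auto simp: admissible_def tile_above_def tile_below_def cell_above_def cell_below_def
        touches_from_below_def steps)
  ultimately have "\<exists>S'. (w, S') \<in> path_domino_tilings m n \<and> (\<lambda>i'. VDom i' j) ` {i..m} \<subseteq> S'"
    using assms by (intro extend_by_monominos) (auto simp: steps disjoint_family_on_def)
  moreover have "touches_from_below w (VDom i j)"
    using assms by (auto simp: touches_from_below_def tile_below_def cell_below_def steps)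
  moreover have "VDom i j \<in> (\<lambda>i'. VDom i' j) ` {i..m}"
    using assms by simp
  ultimately show ?thesis
    using that by blast
qed

text \<open>For the path along the left and top sides the special dominos fill the rows
  \<open>n - 1\<close> and \<open>n\<close>; the bound \<open>n - 2\<close> keeps the given domino
  below them.\<close>

lemma nonspecial_VDom_occurs:
  assumes "i \<in> {1..m}" and "j \<in> {2..n - 2}"
  obtains w S where "(w, S) \<in> path_domino_tilings m n" and "VDom i j \<in> S"
    and "\<not> touches_from_below w (VDom i j)"
proof -
  define w where "w = replicate n North @ replicate m East"
  have steps: "east_steps w = {1..m} \<times> {n}"
    using east_steps_replicate_North[of "[]" n]
    by (simp add: w_def east_steps_replicate_East count_list_replicate)
  have "w \<in> lattice_paths m n"
    by (simp add: w_def lattice_paths_def count_list_replicate)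
  moreover have "admissible w (VDom i' j')" if "i' \<in> {1..m}" "j' \<in> {2..n}" for i' j'
    using that by (auto simp: admissible_def tile_above_def tile_below_def cell_above_def cell_below_def
        touches_from_below_def steps)
  ultimately have "\<exists>S'. (w, S') \<in> path_domino_tilings m n \<and> insert (VDom i j) ((\<lambda>i. VDom i n) ` {1..m}) \<subseteq> S'"
    using assms by (intro extend_by_monominos) (auto simp: steps disjoint_family_on_def)
  moreover have "\<not> touches_from_below w (VDom i j)"
    using assms by (auto simp: touches_from_below_def steps)
  ultimately show ?thesis
    using that[of w] by auto
qed

text \<open>The assumption speaks only of tiles that occur in some tiling, so each denominator is
  reached through one of the three witnesses above.\<close>

lemma weight_denominators_nonzero:
  assumes "\<And>w S t. (w, S) \<in> path_domino_tilings m n \<Longrightarrow> t \<in> S \<Longrightarrow> tile_weight_den a b q p w t \<noteq> 0"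
  shows "i \<in> {2..m} \<Longrightarrow> j \<in> {1..n} \<Longrightarrow> omega1_den a b q p i j \<noteq> 0"
    and "i \<in> {1..m} \<Longrightarrow> j \<in> {2..n} \<Longrightarrow> omega2_den a b q p i j \<noteq> 0"
    and "i \<in> {1..m} \<Longrightarrow> j \<in> {2..n - 2} \<Longrightarrow> omega1_den a b q p j i \<noteq> 0"
proof -
  show "omega1_den a b q p i j \<noteq> 0" if "i \<in> {2..m}" "j \<in> {1..n}"
    using HDom_occurs[OF that] assms by (metis tile_weight_den.simps(2))
  show "omega2_den a b q p i j \<noteq> 0" if "i \<in> {1..m}" "j \<in> {2..n}"
    using special_VDom_occurs[OF that] assms by (metis tile_weight_den.simps(3))
  show "omega1_den a b q p j i \<noteq> 0" if "i \<in> {1..m}" "j \<in> {2..n - 2}"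
    using nonspecial_VDom_occurs[OF that] assms by (metis tile_weight_den.simps(3))
qed

section \<open>Elliptic numbers and the Fibonomial recurrence\<close>

text \<open>The function \<open>N(X)\<close>. As it depends on \<open>q\<close> only through
  \<open>X\<close>, the bases \<open>q\<close> and \<open>q ^ fib j\<close> can be treated
  together.\<close>

definition ell_quotient :: "complex \<Rightarrow> complex \<Rightarrow> complex \<Rightarrow> complex \<Rightarrow> complex" where
  "ell_quotient a b p X = theta X p * theta (a * X) p / (theta (b * X) p * theta (a / b * X) p)"

lemma ell_num_conv: "ell_num a b q p n = ell_quotient a b p (q ^ n) / ell_quotient a b p q"
  by (simp add: ell_num_def ell_num_den_def thetas_def ell_quotient_def mult_ac)

text \<open>This is \<open>theta_addition\<close> divided by its denominators. The last two
  assumptions concern factors that cancel between the numerator of \<open>v_weight\<close> and the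
  denominator of \<open>N(q ^ n)\<close>.\<close>

lemma ell_quotient_add:
  assumes "norm p < 1" and "a \<noteq> 0" and "b \<noteq> 0" and "q \<noteq> 0" and den: "v_den a b q p m n \<noteq> 0"
    and "theta (b * q ^ n) p \<noteq> 0" and "theta (a / b * q ^ n) p \<noteq> 0"
  shows "ell_quotient a b p (q ^ (m + n)) =
    ell_quotient a b p (q ^ m) + v_weight a b q p m n * ell_quotient a b p (q ^ n)"
proof -
  define X Y where "X = q ^ m" and "Y = q ^ n"
  have pow: "q ^ (m + n) = X * Y" "q ^ (2 * m + n) = X\<^sup>2 * Y"
    by (simp_all add: X_def Y_def power_add mult.commute flip: power_mult)
  have nz: "theta (a * Y) p \<noteq> 0" "theta (b * X) p \<noteq> 0" "theta (b * X * Y) p \<noteq> 0"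
      "theta (a / b * X) p \<noteq> 0" "theta (a / b * X * Y) p \<noteq> 0"
      "theta (b * Y) p \<noteq> 0" "theta (a / b * Y) p \<noteq> 0"
    using assms(5-7) unfolding v_den_def pow X_def[symmetric] Y_def[symmetric]
    by (simp_all add: thetas_def mult.assoc)
  have add: "theta (X * Y) p * theta (a * X * Y) p * theta (b * X) p * theta (a / b * X) p =
         theta X p * theta (a * X) p * theta (b * X * Y) p * theta (a / b * X * Y) p +
         X * theta (a * X\<^sup>2 * Y) p * theta Y p * theta b p * theta (a / b) p"
    using assms by (intro theta_addition) (simp_all add: X_def Y_def)
  have frac: "u / d' = w / d + k / (d * d')" if "u * d = w * d' + k" "d \<noteq> 0" "d' \<noteq> 0"
    for u w k d d' :: complex
    using that by (simp add: divide_simps)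
  let ?k = "X * theta (a * X\<^sup>2 * Y) p * theta Y p * theta b p * theta (a / b) p"
  let ?d = "\<lambda>Z. theta (b * Z) p * theta (a / b * Z) p"
  have "ell_quotient a b p (X * Y) = ell_quotient a b p X + ?k / (?d X * ?d (X * Y))"
    unfolding ell_quotient_def using nz add by (intro frac) (simp_all add: mult.assoc)
  moreover have "v_weight a b q p m n * ell_quotient a b p (q ^ n) = ?k / (?d X * ?d (X * Y))"
    unfolding v_weight_def v_den_def ell_quotient_def pow X_def[symmetric] Y_def[symmetric]
    using nz by (simp add: thetas_def divide_simps mult.assoc)
  ultimately show ?thesis
    by (simp add: pow X_def)
qed

text \<open>In base \<open>q ^ fib j\<close> the addition formula at consecutive Fibonacci exponents
  is the recursion of \<open>strip_sum\<close>; both initial values are 1 because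
  \<open>fib 1 = fib 2 = 1\<close>.\<close>

lemma strip_sum_omega1:
  assumes "norm p < 1" and "a \<noteq> 0" and "b \<noteq> 0" and "q \<noteq> 0"
    and Q: "ell_quotient a b p (q ^ fib j) \<noteq> 0"
    and den: "\<And>i. i \<in> {2..k} \<Longrightarrow> omega1_den a b q p i j \<noteq> 0"
  shows "strip_sum (\<lambda>i. omega1 a b q p i j) k =
    ell_quotient a b p (q ^ (fib j * fib (Suc k))) / ell_quotient a b p (q ^ fib j)"
  using den
proof (induction k rule: induct_nat_012)
  case (ge2 k)
  let ?q = "q ^ fib j"
  \<comment> \<open>These factors occur in the denominator of a domino ending one cell earlier. For
    \<open>k = 0\<close> there is none, and \<open>Q\<close> supplies them, since a quotient with
    denominator 0 would be 0.\<close>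
  have "theta (b * ?q ^ fib (Suc k)) p \<noteq> 0 \<and> theta (a / b * ?q ^ fib (Suc k)) p \<noteq> 0"
  proof (cases "k = 0")
    case True
    then show ?thesis
      using Q by (simp add: ell_quotient_def)
  next
    case False
    then have "omega1_den a b q p (Suc k) j \<noteq> 0"
      using ge2.prems[of "Suc k"] by simp
    then show ?thesis
      by (simp add: omega1_den_def v_den_def thetas_def)
  qed
  then have "ell_quotient a b p (?q ^ (fib (Suc (Suc k)) + fib (Suc k))) =
      ell_quotient a b p (?q ^ fib (Suc (Suc k))) +
      omega1 a b q p (Suc (Suc k)) j * ell_quotient a b p (?q ^ fib (Suc k))"
    unfolding omega1_def using ge2.prems[of "Suc (Suc k)"] assms(1-4)
    by (subst ell_quotient_add) (simp_all add: omega1_den_def)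
  moreover have "fib (Suc (Suc (Suc k))) = fib (Suc (Suc k)) + fib (Suc k)"
    by simp
  ultimately show ?case
    using ge2 by (simp only: strip_sum.simps power_mult) (simp add: add_divide_distrib)
qed (use Q in simp_all)

section \<open>The product formula for the tiling sums\<close>

lemma fib_add_pred: "j \<ge> 1 \<Longrightarrow> fib (i + j) = fib (i + 1) * fib j + fib i * fib (j - 1)"
  using fib_add[of i "j - 1"] by (cases j) (simp_all add: algebra_simps)

text \<open>The Fibonomial identity in product form, by nested induction since the recurrence lowers
  either side of the rectangle. The values of \<open>Q\<close> stand for the elliptic numbers
  without their common normalisation.\<close>

lemma path_domino_sum_product:
  fixes a b q p :: complex
  defines "Q \<equiv> \<lambda>k. ell_quotient a b p (q ^ k)"
  assumes "norm p < 1" and "a \<noteq> 0" and "b \<noteq> 0" and "q \<noteq> 0"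
    and Qm: "\<And>i. i \<in> {1..m} \<Longrightarrow> Q (fib i) \<noteq> 0"
    and Qn: "\<And>i. i \<in> {1..n} \<Longrightarrow> Q (fib i) \<noteq> 0"
    and den1: "\<And>i j. i \<in> {2..m} \<Longrightarrow> j \<in> {1..n} \<Longrightarrow> omega1_den a b q p i j \<noteq> 0"
    and den2: "\<And>i j. i \<in> {1..m} \<Longrightarrow> j \<in> {2..n} \<Longrightarrow> omega2_den a b q p i j \<noteq> 0"
    and den3: "\<And>i j. i \<in> {1..m} \<Longrightarrow> j \<in> {2..n - 2} \<Longrightarrow> omega1_den a b q p j i \<noteq> 0"
  shows "path_domino_sum a b q p m n * (\<Prod>k=1..m. Q (fib k)) * (\<Prod>k=1..n. Q (fib k)) =
    (\<Prod>k=1..m + n. Q (fib k))"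
proof -
  define P where "P k = (\<Prod>i=1..k. Q (fib i))" for k
  have P_Suc: "P (Suc k) = P k * Q (fib (Suc k))" for k
    by (simp add: P_def)
  have "path_domino_sum a b q p i j * P i * P j = P (i + j)" if "i \<le> m" "j \<le> n" for i j
    using that
  proof (induction i arbitrary: j)
    case 0
    then show ?case
      by (simp add: path_domino_sum_0 P_def)
  next
    case (Suc i)
    note outer = Suc.IH and i = Suc.prems(1)
    from Suc.prems(2) show ?case
    proof (induction j)
      case 0
      then show ?case
        by (simp add: path_domino_sum_0 P_def)
    next
      case (Suc j)
      have Qi: "Q (fib (Suc i)) \<noteq> 0" and Qj: "Q (fib (Suc j)) \<noteq> 0"
        using Qm[of "Suc i"] Qn[of "Suc j"] i Suc.prems by auto
      have row: "strip_sum (\<lambda>i. omega1 a b q p i (Suc j)) (Suc i) =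
          Q (fib (Suc j) * fib (Suc (Suc i))) / Q (fib (Suc j))"
        unfolding Q_def using assms(2-5) Qj i Suc.prems
        by (intro strip_sum_omega1 den1) (auto simp: Q_def)
      define C where "C = (if j = 0 then 0
        else omega2 a b q p (Suc i) (Suc j) * strip_sum (\<lambda>j. omega1 a b q p j (Suc i)) (j - 1))"
      \<comment> \<open>The addition formula along \<open>fib_add_pred\<close>: the summands are the
        row weight times \<open>Q (fib (Suc j))\<close> and the column weight times
        \<open>Q (fib (Suc i))\<close>. At \<open>j = 0\<close> the second one is absent.\<close>
      have split: "Q (fib (Suc i + Suc j)) = Q (fib (Suc j) * fib (Suc (Suc i))) + C * Q (fib (Suc i))"
      proof (cases "j = 0")
        case True
        then show ?thesis
          by (simp add: C_def)
      next
        case False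
        have col: "strip_sum (\<lambda>j. omega1 a b q p j (Suc i)) (j - 1) =
            Q (fib (Suc i) * fib j) / Q (fib (Suc i))"
        proof -
          have "strip_sum (\<lambda>j. omega1 a b q p j (Suc i)) (j - 1) =
              Q (fib (Suc i) * fib (Suc (j - 1))) / Q (fib (Suc i))"
            unfolding Q_def using assms(2-5) Qi i Suc.prems
            by (intro strip_sum_omega1 den3) (auto simp: Q_def)
          then show ?thesis
            using False by simp
        qed
        \<comment> \<open>These factors cancel in \<open>omega2 * Q\<close> only if they do not vanish; they occur in the
          denominators of non-special vertical dominos, unless \<open>fib j = 1\<close>.\<close>
        have "theta (b * q ^ (fib (Suc i) * fib j)) p \<noteq> 0 \<and> theta (a / b * q ^ (fib (Suc i) * fib j)) p \<noteq> 0"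
        proof (cases "j \<le> 2")
          case True
          then have "j = 1 \<or> j = 2"
            using False by auto
          then have "fib j = 1"
            by auto
          then show ?thesis
            using Qi by (auto simp: Q_def ell_quotient_def)
        next
          case False
          then have "j - 1 \<in> {2..n - 2}"
            using Suc.prems unfolding atLeastAtMost_iff by linarith
          then have "omega1_den a b q p (j - 1) (Suc i) \<noteq> 0"
            using den3[of "Suc i" "j - 1"] i by simp
          \<comment> \<open>The sum of the two exponents in \<open>omega1_den\<close> is
            \<open>fib j\<close>, and \<open>v_den\<close> contains the required theta values at
            this sum.\<close>
          moreover have "fib (j - 1) + fib (j - 1 - 1) = fib j"
            using False by (cases j rule: fib.cases) auto
          ultimately show ?thesis
            by (simp add: omega1_den_def v_den_def thetas_def power_mult)
        qed
        then have "Q (fib (Suc i + 1) * fib (Suc j) + fib (Suc i) * fib (Suc j - 1)) =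
            Q (fib (Suc i + 1) * fib (Suc j)) +
            omega2 a b q p (Suc i) (Suc j) * Q (fib (Suc i) * fib (Suc j - 1))"
          unfolding Q_def omega2_def using assms(2-5) den2[of "Suc i" "Suc j"] i Suc.prems False
          by (intro ell_quotient_add) (auto simp: omega2_den_def)
        then have "Q (fib (Suc i + Suc j)) = Q (fib (Suc j) * fib (Suc (Suc i))) +
            omega2 a b q p (Suc i) (Suc j) * Q (fib (Suc i) * fib j)"
          by (subst fib_add_pred) (simp_all add: mult.commute)
        moreover have "C * Q (fib (Suc i)) = omega2 a b q p (Suc i) (Suc j) * Q (fib (Suc i) * fib j)"
          unfolding C_def col using False Qi by simp
        ultimately show ?thesis
          by simp
      qed
      have IH1: "path_domino_sum a b q p (Suc i) j * P (Suc i) * P j = P (Suc (i + j))"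
        using Suc.IH Suc.prems by simp
      have IH2: "path_domino_sum a b q p i (Suc j) * P i * P (Suc j) = P (Suc (i + j))"
        using outer[of "Suc j"] i Suc.prems by simp
      \<comment> \<open>The factor split off from \<open>P (Suc j)\<close> cancels the denominator
        of \<open>row\<close>; the one from \<open>P (Suc i)\<close> goes to
        \<open>C\<close>.\<close>
      have "path_domino_sum a b q p (Suc i) (Suc j) * P (Suc i) * P (Suc j) =
          Q (fib (Suc j) * fib (Suc (Suc i))) * (path_domino_sum a b q p (Suc i) j * P (Suc i) * P j) +
          C * Q (fib (Suc i)) * (path_domino_sum a b q p i (Suc j) * P i * P (Suc j))"
        unfolding path_domino_sum_Suc_Suc C_def[symmetric] row P_Suc
        using Qi Qj by (simp add: field_simps)
      also have "\<dots> = Q (fib (Suc i + Suc j)) * P (Suc (i + j))"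
        unfolding IH1 IH2 split by (simp only: distrib_right)
      also have "\<dots> = P (Suc i + Suc j)"
        using P_Suc[of "Suc (i + j)"] by (simp only: add_Suc add_Suc_right mult.commute)
      finally show ?case .
    qed
  qed
  from this[of m n] show ?thesis
    by (simp add: P_def)
qed

theorem theorem3p1:
  fixes a b q p :: complex and m n :: nat
  assumes "m \<ge> 1" and "n \<ge> 1"
    and "a \<noteq> 0" and "b \<noteq> 0" and "q \<noteq> 0" and "norm p < 1"
    and "\<And>k. k \<in> {1..m + n} \<Longrightarrow> ell_num_den a b q p (fib k) \<noteq> 0"
    and "ell_fib_fact a b q p m * ell_fib_fact a b q p n \<noteq> 0"
    and "\<And>w S t. (w, S) \<in> path_domino_tilings m n \<Longrightarrow> t \<in> S \<Longrightarrow>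
           tile_weight_den a b q p w t \<noteq> 0"
  shows "ell_fibonomial a b q p (m + n) n =
           (\<Sum>T\<in>path_domino_tilings m n. elliptic_weight a b q p T)"
proof -
  define Q where "Q k = ell_quotient a b p (q ^ k)" for k
  define P where "P k = (\<Prod>i=1..k. Q (fib i))" for k
  \<comment> \<open>Every elliptic number carries the denominator \<open>Q 1\<close>. In the
    Fibonomial these powers cancel, since their exponents \<open>m\<close> and \<open>n\<close> add
    up to \<open>m + n\<close>.\<close>
  have fact_conv: "ell_fib_fact a b q p k = P k / Q 1 ^ k" for k
    by (simp add: ell_fib_fact_def P_def Q_def ell_num_conv prod_dividef)
  \<comment> \<open>As \<open>m \<ge> 1\<close>, a vanishing \<open>Q 1\<close> would make the
    factorial 0, division by 0 being 0.\<close>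
  then have nz: "P m \<noteq> 0" "P n \<noteq> 0" "Q 1 \<noteq> 0"
    using assms(1,8) by auto
  have "path_domino_sum a b q p m n * P m * P n = P (m + n)"
    unfolding P_def Q_def
  proof (rule path_domino_sum_product)
    show "ell_quotient a b p (q ^ fib i) \<noteq> 0" if "i \<in> {1..m}" for i
      using nz(1) that by (auto simp: P_def Q_def)
    show "ell_quotient a b p (q ^ fib i) \<noteq> 0" if "i \<in> {1..n}" for i
      using nz(2) that by (auto simp: P_def Q_def)
  qed (use assms weight_denominators_nonzero[OF assms(9)] in auto)
  then have "path_domino_sum a b q p m n = P (m + n) / (P m * P n)"
    using nz by (simp add: field_simps)
  moreover have "ell_fibonomial a b q p (m + n) n = P (m + n) / (P m * P n)"
    using nz by (simp add: ell_fibonomial_def fact_conv power_add)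
  ultimately show ?thesis
    by (simp add: path_domino_sum_def)
qed

end
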